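(* Let $R$ be a left Artinian ring and $S$ be a multiplicative set of $R$. The following statements are equivalent. 1. $S\in\mathrm{Den}_l(R)$. 2. There is a nonzero idempotent $e\in R$ such that $eR(1-e)=0$, $S\subseteq\begin{pmatrix} R_{11}^* & 0 \\ R_{21} & R_{22} \end{pmatrix}$, and there is an element $s\in S$ of the form $s=\begin{pmatrix} u & 0 \\ v & 0 \end{pmatrix}$, where $R=\begin{pmatrix} R_{11} & 0 \\ R_{21} & R_{22} \end{pmatrix}$ is the matrix ring associated with the idempotent $e$. 3. There are a unit $\lambda\in R^*$, an idempotent $e\in\mathcal I_l'(R)$ and an element $s\in S$ such that $\lambda S\lambda^{-1}\subseteq\begin{pmatrix} R_{11}^* & 0 \\ R_{21} & R_{22} \end{pmatrix}$ and $\lambda s\lambda^{-1}=\begin{pmatrix} u & 0 \\ v & 0 \end{pmatrix}$, where $R=\begin{pmatrix} R_{11} & 0 \\ R_{21} & R_{22} \end{pmatrix}$ is the matrix ring associated with the idempotent $e$. 4. There is an element $s\in S$ such that $S_s:=\{s^i: i\in\mathbb N\}\in\mathrm{Den}_l(R)$ and the images of all the elements of $S$ in the ring $S_s^{-1}R$ are units. If one of the equivalent conditions holds then $\mathrm{ass}(S)=\ker_R(s\,\cdot)$ in cases 2 and 3, regardless of the choice of $s$.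
   Context: Rings are associative with $1\neq0$; $A^*$ is the group of units of a ring $A$; $\mathbb N=\{0,1,2,\dots\}$. A multiplicative set $S\subseteq R$ satisfies $1\in S$, $SS\subseteq S$, $0\notin S$. It is a left Ore set if $Sr\cap Rs\neq\emptyset$ for all $r\in R$, $s\in S$; put $\mathrm{ass}(S)=\{r\in R:sr=0\text{ for some }s\in S\}$. A left Ore set $S$ is a left denominator set if $rs=0$ with $r\in R$, $s\in S$ implies $tr=0$ for some $t\in S$; $\mathrm{Den}_l(R)$ is the set of left denominator sets and $S^{-1}R$ denotes the left localization. $\ker_R(s\,\cdot)=\{r\in R: sr=0\}$. For an idempotent $e$, put $e_1=e$, $e_2=1-e$, $R_{ij}=e_iRe_j$; the matrix ring associated with $e$ is the identification $R=\bigoplus_{i,j=1}^2R_{ij}=\begin{pmatrix} R_{11} & R_{12} \\ R_{21} & R_{22} \end{pmatrix}$. $R_{11}^*$ is the group of units of $R_{11}=eRe$. For $R$ left Artinian, write $R/\mathrm{rad}(R)=\prod_{i=1}^s\overline R_i$, a product of simple Artinian rings ($\mathrm{rad}$ = Jacobson radical), with $\overline1_i$ the identity of $\overline R_i$. Fix orthogonal idempotents $1_1,\dots,1_s$ of $R$ with $1=\sum_i1_i$ and $1_i+\mathrm{rad}(R)=\overline1_i$. For nonempty $I\subseteq\{1,\dots,s\}$ put $e_I=\sum_{i\in I}1_i$. Then $\mathcal I_l'(R)=\{e_I:\emptyset\neq I\subseteq\{1,\dots,s\},\ e_IR(1-e_I)=0\}$. *)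

theory Defs
  imports "HOL-Algebra.Algebra"
begin

section \<open>Left Artinian rings and the Jacobson radical\<close>

definition left_ideal :: "('a, 'm) ring_scheme \<Rightarrow> 'a set \<Rightarrow> bool"
  where "left_ideal R L \<longleftrightarrow>
    additive_subgroup L R \<and> (\<forall>r\<in>carrier R. \<forall>x\<in>L. r \<otimes>\<^bsub>R\<^esub> x \<in> L)"

definition left_artinian :: "('a, 'm) ring_scheme \<Rightarrow> bool"
  where "left_artinian R \<longleftrightarrow>
    (\<forall>L :: nat \<Rightarrow> 'a set.
       (\<forall>n. left_ideal R (L n) \<and> L (Suc n) \<subseteq> L n) \<longrightarrow> (\<exists>n. \<forall>m\<ge>n. L m = L n))"

definition maximal_left_ideal :: "('a, 'm) ring_scheme \<Rightarrow> 'a set \<Rightarrow> bool"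
  where "maximal_left_ideal R M \<longleftrightarrow>
    left_ideal R M \<and> M \<noteq> carrier R \<and>
    (\<forall>L. left_ideal R L \<and> M \<subseteq> L \<longrightarrow> L = M \<or> L = carrier R)"

definition jacobson_radical :: "('a, 'm) ring_scheme \<Rightarrow> 'a set"
  where "jacobson_radical R = carrier R \<inter> \<Inter> {M. maximal_left_ideal R M}"

definition simple_artinian_ring :: "('a, 'm) ring_scheme \<Rightarrow> bool"
  where "simple_artinian_ring R \<longleftrightarrow>
    ring R \<and> \<one>\<^bsub>R\<^esub> \<noteq> \<zero>\<^bsub>R\<^esub> \<and>
    (\<forall>I. ideal I R \<longrightarrow> I = {\<zero>\<^bsub>R\<^esub>} \<or> I = carrier R) \<and>
    left_artinian R"


section \<open>Ore sets, denominator sets and left localization\<close>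

definition multiplicative_set :: "('a, 'm) ring_scheme \<Rightarrow> 'a set \<Rightarrow> bool"
  where "multiplicative_set R S \<longleftrightarrow>
    S \<subseteq> carrier R \<and> \<one>\<^bsub>R\<^esub> \<in> S \<and> (\<forall>s\<in>S. \<forall>t\<in>S. s \<otimes>\<^bsub>R\<^esub> t \<in> S) \<and> \<zero>\<^bsub>R\<^esub> \<notin> S"

definition left_Ore_set :: "('a, 'm) ring_scheme \<Rightarrow> 'a set \<Rightarrow> bool"
  where "left_Ore_set R S \<longleftrightarrow>
    multiplicative_set R S \<and>
    (\<forall>r\<in>carrier R. \<forall>s\<in>S.
       {t \<otimes>\<^bsub>R\<^esub> r | t. t \<in> S} \<inter> {q \<otimes>\<^bsub>R\<^esub> s | q. q \<in> carrier R} \<noteq> {})"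

definition ass :: "('a, 'm) ring_scheme \<Rightarrow> 'a set \<Rightarrow> 'a set"
  where "ass R S = {r \<in> carrier R. \<exists>s\<in>S. s \<otimes>\<^bsub>R\<^esub> r = \<zero>\<^bsub>R\<^esub>}"

definition lmult_ker :: "('a, 'm) ring_scheme \<Rightarrow> 'a \<Rightarrow> 'a set"
  where "lmult_ker R s = {r \<in> carrier R. s \<otimes>\<^bsub>R\<^esub> r = \<zero>\<^bsub>R\<^esub>}"

definition Den_l :: "('a, 'm) ring_scheme \<Rightarrow> 'a set set"
  where "Den_l R =
    {S. left_Ore_set R S \<and>
        (\<forall>r\<in>carrier R. \<forall>s\<in>S. r \<otimes>\<^bsub>R\<^esub> s = \<zero>\<^bsub>R\<^esub> \<longrightarrow> (\<exists>t\<in>S. t \<otimes>\<^bsub>R\<^esub> r = \<zero>\<^bsub>R\<^esub>))}"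

text \<open>Ore's construction. The pair \<open>(s, r)\<close> stands for \<open>s\<^sup>-\<^sup>1 r\<close>; two pairs are identified iff
  they agree after being brought to some common denominator \<open>a s = b s'\<close> in \<open>S\<close>.\<close>

definition frac_rel :: "('a, 'm) ring_scheme \<Rightarrow> 'a set \<Rightarrow> (('a \<times> 'a) \<times> ('a \<times> 'a)) set"
  where "frac_rel R S =
    {((s, r), (s', r')) | s r s' r'.
       s \<in> S \<and> r \<in> carrier R \<and> s' \<in> S \<and> r' \<in> carrier R \<and>
       (\<exists>a\<in>carrier R. \<exists>b\<in>carrier R.
          a \<otimes>\<^bsub>R\<^esub> s = b \<otimes>\<^bsub>R\<^esub> s' \<and> a \<otimes>\<^bsub>R\<^esub> s \<in> S \<and> a \<otimes>\<^bsub>R\<^esub> r = b \<otimes>\<^bsub>R\<^esub> r')}"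

definition ofrac :: "('a, 'm) ring_scheme \<Rightarrow> 'a set \<Rightarrow> 'a \<Rightarrow> 'a \<Rightarrow> ('a \<times> 'a) set"
  where "ofrac R S s r = frac_rel R S `` {(s, r)}"

text \<open>Sum and product are the unions, over all representatives and all choices of Ore
  multipliers, of the resulting classes; for a left denominator set all these classes coincide.
  The sum uses \<open>s\<^sup>-\<^sup>1 r + s'\<^sup>-\<^sup>1 r' = (a s)\<^sup>-\<^sup>1 (a r + b r')\<close> if \<open>a s = b s' \<in> S\<close>,
  the product uses \<open>s\<^sup>-\<^sup>1 r \<cdot> s'\<^sup>-\<^sup>1 r' = (t s)\<^sup>-\<^sup>1 (a r')\<close> if \<open>t r = a s'\<close> with \<open>t \<in> S\<close>.\<close>

definition frac_add :: "('a, 'm) ring_scheme \<Rightarrow> 'a set \<Rightarrow>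
    ('a \<times> 'a) set \<Rightarrow> ('a \<times> 'a) set \<Rightarrow> ('a \<times> 'a) set"
  where "frac_add R S P Q =
    {z. \<exists>s r s' r' a b.
       z \<in> ofrac R S (a \<otimes>\<^bsub>R\<^esub> s) (a \<otimes>\<^bsub>R\<^esub> r \<oplus>\<^bsub>R\<^esub> b \<otimes>\<^bsub>R\<^esub> r') \<and>
       (s, r) \<in> P \<and> (s', r') \<in> Q \<and> a \<in> carrier R \<and> b \<in> carrier R \<and>
       a \<otimes>\<^bsub>R\<^esub> s = b \<otimes>\<^bsub>R\<^esub> s' \<and> a \<otimes>\<^bsub>R\<^esub> s \<in> S}"

definition frac_mult :: "('a, 'm) ring_scheme \<Rightarrow> 'a set \<Rightarrow>
    ('a \<times> 'a) set \<Rightarrow> ('a \<times> 'a) set \<Rightarrow> ('a \<times> 'a) set"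
  where "frac_mult R S P Q =
    {z. \<exists>s r s' r' a t.
       z \<in> ofrac R S (t \<otimes>\<^bsub>R\<^esub> s) (a \<otimes>\<^bsub>R\<^esub> r') \<and>
       (s, r) \<in> P \<and> (s', r') \<in> Q \<and> a \<in> carrier R \<and> t \<in> S \<and>
       t \<otimes>\<^bsub>R\<^esub> r = a \<otimes>\<^bsub>R\<^esub> s'}"

definition left_localization :: "('a, 'm) ring_scheme \<Rightarrow> 'a set \<Rightarrow> ('a \<times> 'a) set ring"
  where "left_localization R S =
    \<lparr> carrier = (S \<times> carrier R) // frac_rel R S,
      monoid.mult = frac_mult R S,
      one = ofrac R S \<one>\<^bsub>R\<^esub> \<one>\<^bsub>R\<^esub>,
      ring.zero = ofrac R S \<one>\<^bsub>R\<^esub> \<zero>\<^bsub>R\<^esub>,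
      ring.add = frac_add R S \<rparr>"

definition loc_map :: "('a, 'm) ring_scheme \<Rightarrow> 'a set \<Rightarrow> 'a \<Rightarrow> ('a \<times> 'a) set"
  where "loc_map R S r = ofrac R S \<one>\<^bsub>R\<^esub> r"

definition powers_of :: "('a, 'm) ring_scheme \<Rightarrow> 'a \<Rightarrow> 'a set"
  where "powers_of R s = range (\<lambda>i::nat. s [^]\<^bsub>R\<^esub> i)"


section \<open>The matrix ring associated with an idempotent\<close>

definition is_idempotent :: "('a, 'm) ring_scheme \<Rightarrow> 'a \<Rightarrow> bool"
  where "is_idempotent R e \<longleftrightarrow> e \<in> carrier R \<and> e \<otimes>\<^bsub>R\<^esub> e = e"

definition peirce :: "('a, 'm) ring_scheme \<Rightarrow> 'a \<Rightarrow> 'a \<Rightarrow> 'a set"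
  where "peirce R e f = {e \<otimes>\<^bsub>R\<^esub> x \<otimes>\<^bsub>R\<^esub> f | x. x \<in> carrier R}"

abbreviation R11 :: "('a, 'm) ring_scheme \<Rightarrow> 'a \<Rightarrow> 'a set"
  where "R11 R e \<equiv> peirce R e e"

abbreviation R12 :: "('a, 'm) ring_scheme \<Rightarrow> 'a \<Rightarrow> 'a set"
  where "R12 R e \<equiv> peirce R e (\<one>\<^bsub>R\<^esub> \<ominus>\<^bsub>R\<^esub> e)"

abbreviation R21 :: "('a, 'm) ring_scheme \<Rightarrow> 'a \<Rightarrow> 'a set"
  where "R21 R e \<equiv> peirce R (\<one>\<^bsub>R\<^esub> \<ominus>\<^bsub>R\<^esub> e) e"

abbreviation R22 :: "('a, 'm) ring_scheme \<Rightarrow> 'a \<Rightarrow> 'a set"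
  where "R22 R e \<equiv> peirce R (\<one>\<^bsub>R\<^esub> \<ominus>\<^bsub>R\<^esub> e) (\<one>\<^bsub>R\<^esub> \<ominus>\<^bsub>R\<^esub> e)"

definition corner_ring :: "('a, 'm) ring_scheme \<Rightarrow> 'a \<Rightarrow> ('a, 'm) ring_scheme"
  where "corner_ring R e = R\<lparr>carrier := R11 R e, one := e\<rparr>"

text \<open>The identification of a \<open>2 \<times> 2\<close> array of Peirce components with an element of \<open>R\<close>.\<close>

definition pmat :: "('a, 'm) ring_scheme \<Rightarrow> 'a \<Rightarrow> 'a \<Rightarrow> 'a \<Rightarrow> 'a \<Rightarrow> 'a"
  where "pmat R a b c d = a \<oplus>\<^bsub>R\<^esub> b \<oplus>\<^bsub>R\<^esub> c \<oplus>\<^bsub>R\<^esub> d"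

definition pmat_set :: "('a, 'm) ring_scheme \<Rightarrow> 'a set \<Rightarrow> 'a set \<Rightarrow> 'a set \<Rightarrow> 'a set \<Rightarrow> 'a set"
  where "pmat_set R A B C D =
    {pmat R a b c d | a b c d. a \<in> A \<and> b \<in> B \<and> c \<in> C \<and> d \<in> D}"


section \<open>The semisimple quotient and lifted idempotents\<close>

text \<open>\<open>Q\<close> is the internal direct product of the ideals \<open>B 1, \<dots>, B n\<close>, where \<open>B i\<close> is a simple
  Artinian ring with identity \<open>c i\<close>.\<close>

definition product_of_simple_artinians ::
    "('b, 'm) ring_scheme \<Rightarrow> nat \<Rightarrow> (nat \<Rightarrow> 'b set) \<Rightarrow> (nat \<Rightarrow> 'b) \<Rightarrow> bool"
  where "product_of_simple_artinians Q n B c \<longleftrightarrow>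
    (\<forall>i\<in>{1..n}. ideal (B i) Q \<and> simple_artinian_ring (Q\<lparr>carrier := B i, one := c i\<rparr>)) \<and>
    bij_betw (\<lambda>x. \<Oplus>\<^bsub>Q\<^esub>i\<in>{1..n}. x i) (\<Pi>\<^sub>E i\<in>{1..n}. B i) (carrier Q)"

definition lifted_idempotents ::
    "('a, 'm) ring_scheme \<Rightarrow> nat \<Rightarrow> (nat \<Rightarrow> 'a set set) \<Rightarrow> (nat \<Rightarrow> 'a set) \<Rightarrow> (nat \<Rightarrow> 'a) \<Rightarrow> bool"
  where "lifted_idempotents R n B c \<epsilon> \<longleftrightarrow>
    product_of_simple_artinians (R Quot jacobson_radical R) n B c \<and>
    (\<forall>i\<in>{1..n}. is_idempotent R (\<epsilon> i)) \<and>
    (\<forall>i\<in>{1..n}. \<forall>j\<in>{1..n}. i \<noteq> j \<longrightarrow> \<epsilon> i \<otimes>\<^bsub>R\<^esub> \<epsilon> j = \<zero>\<^bsub>R\<^esub>) \<and>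
    \<one>\<^bsub>R\<^esub> = (\<Oplus>\<^bsub>R\<^esub>i\<in>{1..n}. \<epsilon> i) \<and>
    (\<forall>i\<in>{1..n}. jacobson_radical R +>\<^bsub>R\<^esub> \<epsilon> i = c i)"

definition idem_sum :: "('a, 'm) ring_scheme \<Rightarrow> (nat \<Rightarrow> 'a) \<Rightarrow> nat set \<Rightarrow> 'a"
  where "idem_sum R \<epsilon> I = (\<Oplus>\<^bsub>R\<^esub>i\<in>I. \<epsilon> i)"

definition I_l' :: "('a, 'm) ring_scheme \<Rightarrow> nat \<Rightarrow> (nat \<Rightarrow> 'a) \<Rightarrow> 'a set"
  where "I_l' R n \<epsilon> =
    {idem_sum R \<epsilon> I | I. I \<noteq> {} \<and> I \<subseteq> {1..n} \<and> R12 R (idem_sum R \<epsilon> I) = {\<zero>\<^bsub>R\<^esub>}}"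


section \<open>Conditions on a multiplicative set\<close>

definition block_cond :: "('a, 'm) ring_scheme \<Rightarrow> 'a set \<Rightarrow> 'a \<Rightarrow> 'a \<Rightarrow> bool"
  where "block_cond R S e s \<longleftrightarrow>
    is_idempotent R e \<and> e \<noteq> \<zero>\<^bsub>R\<^esub> \<and> R12 R e = {\<zero>\<^bsub>R\<^esub>} \<and>
    S \<subseteq> pmat_set R (Units (corner_ring R e)) {\<zero>\<^bsub>R\<^esub>} (R21 R e) (R22 R e) \<and>
    s \<in> S \<and> (\<exists>u\<in>R11 R e. \<exists>v\<in>R21 R e. s = pmat R u \<zero>\<^bsub>R\<^esub> v \<zero>\<^bsub>R\<^esub>)"

definition conj_block_cond :: "('a, 'm) ring_scheme \<Rightarrow> nat \<Rightarrow> (nat \<Rightarrow> 'a) \<Rightarrow>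
    'a set \<Rightarrow> 'a \<Rightarrow> 'a \<Rightarrow> 'a \<Rightarrow> bool"
  where "conj_block_cond R n \<epsilon> S l e s \<longleftrightarrow>
    l \<in> Units R \<and> e \<in> I_l' R n \<epsilon> \<and> s \<in> S \<and>
    {l \<otimes>\<^bsub>R\<^esub> x \<otimes>\<^bsub>R\<^esub> inv\<^bsub>R\<^esub> l | x. x \<in> S}
      \<subseteq> pmat_set R (Units (corner_ring R e)) {\<zero>\<^bsub>R\<^esub>} (R21 R e) (R22 R e) \<and>
    (\<exists>u\<in>R11 R e. \<exists>v\<in>R21 R e. l \<otimes>\<^bsub>R\<^esub> s \<otimes>\<^bsub>R\<^esub> inv\<^bsub>R\<^esub> l = pmat R u \<zero>\<^bsub>R\<^esub> v \<zero>\<^bsub>R\<^esub>)"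

end

theory Submission
  imports Defs
begin

text \<open>
The condition \<open>e R (1 - e) = 0\<close> means that \<open>x \<mapsto> e x\<close> is a ring homomorphism from \<open>R\<close> onto \<open>e R e\<close>.
All four conditions say that this homomorphism, for a suitable idempotent \<open>e\<close>, is the left
localization of \<open>R\<close> at \<open>S\<close>: the elements of \<open>S\<close> become units, and some \<open>s \<in> S\<close> with \<open>s e = s\<close> kills the
whole kernel \<open>(1 - e) R\<close>. The locale \<open>inverting_idempotent\<close> captures this situation, and
\<open>block_cond_iff\<close> shows that it is the block condition on matrices.

In this situation \<open>s\<close> is a universal Ore multiplier, so \<open>S\<close> is a left denominator set
(\<open>S_in_Den_l\<close>), and both \<open>ass S\<close> and the kernel of \<open>s\<close> equal \<open>{r. e r = 0}\<close> (\<open>ass_eq_lmult_ker\<close>).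
Sending \<open>t\<^sup>-\<^sup>1 r\<close> to \<open>(e t)\<^sup>-\<^sup>1 e r\<close> identifies the multiplicative monoid of the localization with
\<open>e R e\<close>, so \<open>x\<close> becomes a unit in the localization iff \<open>e x\<close> is a unit of \<open>e R e\<close>
(\<open>loc_map_unit_iff\<close>). This yields the condition on powers of a single element.

The converse (\<open>Den_l_imp_inverting_idempotent\<close>) is where the descending chain condition enters.
It provides \<open>s \<in> S\<close> for which \<open>R s\<close> is least among the left ideals \<open>R t\<close> with \<open>t \<in> S\<close>; then
\<open>s = q t s\<close> for each \<open>t \<in> S\<close>, and cancelling \<open>s\<close> on the right, which a denominator set permits at the cost
of multiplying by \<open>s\<close> on the left, gives \<open>s q t = s\<close>. Hence \<open>s\<close> is von Neumann regular, \<open>s p s = s\<close>,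
and \<open>e = p s\<close> is the required idempotent.

For the condition with lifted idempotents, \<open>((1 - e) R e)\<^sup>2 = 0\<close>, so \<open>e\<close> is central modulo the Jacobson
radical. A central idempotent of a product of simple rings is a sum of identities of factors, so
\<open>e\<close> is congruent to a partial sum \<open>f\<close> of the lifted idempotents, and congruent
idempotents are conjugate by a unit of the form \<open>1 - j\<close> with \<open>j\<close> in the radical.
\<close>

section \<open>Peirce components and the block condition\<close>

lemma (in ring) is_idempotentD:
  assumes "is_idempotent R e"
  shows "e \<in> carrier R" "e \<otimes> e = e"
  using assms by (simp_all add: is_idempotent_def)

lemma (in ring) idempotent_complement:
  assumes "is_idempotent R e"
  shows "is_idempotent R (\<one> \<ominus> e)" "e \<otimes> (\<one> \<ominus> e) = \<zero>" "(\<one> \<ominus> e) \<otimes> e = \<zero>"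
proof -
  note e = is_idempotentD[OF assms]
  show 1: "e \<otimes> (\<one> \<ominus> e) = \<zero>"
    using e by (simp add: minus_eq r_distr r_minus r_neg)
  show 2: "(\<one> \<ominus> e) \<otimes> e = \<zero>"
    using e by (simp add: minus_eq l_distr l_minus r_neg)
  have "(\<one> \<ominus> e) \<otimes> (\<one> \<ominus> e) = \<one> \<otimes> (\<one> \<ominus> e) \<ominus> e \<otimes> (\<one> \<ominus> e)"
    using e by (simp add: minus_eq l_distr l_minus)
  then show "is_idempotent R (\<one> \<ominus> e)"
    using e 1 by (simp add: is_idempotent_def minus_eq)
qed

text \<open>Membership by absorption laws, without an existential witness, is what makes the Peirce
components usable for equational reasoning.\<close>

lemma (in ring) mem_peirce_iff:
  assumes "is_idempotent R e" "is_idempotent R f"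
  shows "z \<in> peirce R e f \<longleftrightarrow> z \<in> carrier R \<and> e \<otimes> z = z \<and> z \<otimes> f = z"
proof
  note e = is_idempotentD[OF assms(1)] and f = is_idempotentD[OF assms(2)]
  show "z \<in> carrier R \<and> e \<otimes> z = z \<and> z \<otimes> f = z" if "z \<in> peirce R e f"
  proof -
    from that obtain x where x: "x \<in> carrier R" "z = e \<otimes> x \<otimes> f"
      by (auto simp: peirce_def)
    have "e \<otimes> (e \<otimes> x \<otimes> f) = (e \<otimes> e) \<otimes> x \<otimes> f"
      using e(1) f(1) x(1) by (simp add: m_assoc)
    moreover have "e \<otimes> x \<otimes> f \<otimes> f = e \<otimes> x \<otimes> (f \<otimes> f)"
      using e(1) f(1) x(1) by (simp add: m_assoc)
    ultimately show ?thesis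
      using e f x by simp
  qed
  show "z \<in> peirce R e f" if "z \<in> carrier R \<and> e \<otimes> z = z \<and> z \<otimes> f = z"
    using that unfolding peirce_def by force
qed

text \<open>The vanishing corner \<open>e R (1 - e)\<close> as a rewrite rule. It says that left multiplication by \<open>e\<close>
is a ring homomorphism from \<open>R\<close> onto \<open>e R = e R e\<close>.\<close>

lemma (in ring) R12_eq_zero_iff:
  assumes "is_idempotent R e"
  shows "R12 R e = {\<zero>} \<longleftrightarrow> (\<forall>r\<in>carrier R. e \<otimes> r \<otimes> e = e \<otimes> r)"
proof -
  note e = is_idempotentD[OF assms]
  have eq: "e \<otimes> r \<otimes> (\<one> \<ominus> e) = e \<otimes> r \<ominus> e \<otimes> r \<otimes> e" if "r \<in> carrier R" for r
    using e that by (simp add: minus_eq r_distr r_minus)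
  have "e \<otimes> r \<otimes> (\<one> \<ominus> e) = \<zero> \<longleftrightarrow> e \<otimes> r \<otimes> e = e \<otimes> r" if "r \<in> carrier R" for r
    unfolding eq[OF that] using e that r_right_minus_eq[of "e \<otimes> r" "e \<otimes> r \<otimes> e"] by auto
  then have "(\<forall>r\<in>carrier R. e \<otimes> r \<otimes> (\<one> \<ominus> e) = \<zero>) \<longleftrightarrow>
      (\<forall>r\<in>carrier R. e \<otimes> r \<otimes> e = e \<otimes> r)"
    by auto
  moreover have "R12 R e = {\<zero>} \<longleftrightarrow> (\<forall>r\<in>carrier R. e \<otimes> r \<otimes> (\<one> \<ominus> e) = \<zero>)"
  proof
    show "R12 R e = {\<zero>}" if all: "\<forall>r\<in>carrier R. e \<otimes> r \<otimes> (\<one> \<ominus> e) = \<zero>"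
    proof -
      have "\<zero> = e \<otimes> \<zero> \<otimes> (\<one> \<ominus> e)" using e by simp
      then show ?thesis using all unfolding peirce_def by blast
    qed
  qed (auto simp: peirce_def)
  ultimately show ?thesis by simp
qed

lemma (in ring) mem_Units_corner_iff:
  assumes "is_idempotent R e"
  shows "z \<in> Units (corner_ring R e) \<longleftrightarrow>
    z \<in> R11 R e \<and> (\<exists>y\<in>R11 R e. y \<otimes> z = e \<and> z \<otimes> y = e)"
  by (auto simp: Units_def corner_ring_def)

text \<open>The block condition freed of matrices. Because \<open>x \<mapsto> e x\<close> is a ring homomorphism onto \<open>e R e\<close>,
a lower triangular matrix has an invertible upper left entry iff \<open>e x\<close> is a unit of \<open>e R e\<close>, and
the second column of \<open>s\<close> vanishes iff \<open>s e = s\<close>. The inverse \<open>y\<close> of \<open>e x\<close> is required to satisfy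
only \<open>e y = y\<close>: then \<open>y = e y = e y e\<close> lies in \<open>e R e\<close>, and \<open>y x = y e x\<close>.\<close>

locale inverting_idempotent = ring R for R (structure) +
  fixes S and e and s
  assumes mult_set: "multiplicative_set R S"
    and idem: "is_idempotent R e"
    and absorb: "r \<in> carrier R \<Longrightarrow> e \<otimes> r \<otimes> e = e \<otimes> r"
    and inverse: "x \<in> S \<Longrightarrow> \<exists>y\<in>carrier R. e \<otimes> y = y \<and> y \<otimes> x = e \<and> e \<otimes> x \<otimes> y = e"
    and s_in: "s \<in> S"
    and s_e: "s \<otimes> e = s"
begin

lemma e_closed [simp]: "e \<in> carrier R" and e_e [simp]: "e \<otimes> e = e"
  using idem by (simp_all add: is_idempotent_def)

lemma S_closed [simp]: "x \<in> S \<Longrightarrow> x \<in> carrier R"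
  using mult_set by (auto simp: multiplicative_set_def)

lemma S_mult: "x \<in> S \<Longrightarrow> y \<in> S \<Longrightarrow> x \<otimes> y \<in> S"
  using mult_set by (auto simp: multiplicative_set_def)

lemma S_one: "\<one> \<in> S"
  using mult_set by (auto simp: multiplicative_set_def)

lemma s_closed [simp]: "s \<in> carrier R"
  using s_in by simp

lemma e_nonzero: "e \<noteq> \<zero>"
proof
  assume "e = \<zero>"
  then have "s = \<zero>" using s_e s_closed by simp
  then show False using s_in mult_set by (simp add: multiplicative_set_def)
qed

end

text \<open>For \<open>x = a + c + d\<close> in lower triangular form \<open>e x = a\<close>, since \<open>e\<close> kills \<open>(1 - e) R\<close> from the left;
conversely every \<open>x\<close> splits as \<open>e x + (1 - e) x e + (1 - e) x (1 - e)\<close>. That \<open>e\<close> is nonzero comes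
from \<open>s = s e\<close> and \<open>0 \<notin> S\<close>.\<close>

lemma (in ring) block_cond_iff:
  assumes "multiplicative_set R S"
  shows "block_cond R S e s \<longleftrightarrow> inverting_idempotent R S e s"
proof
  have S: "x \<in> carrier R" if "x \<in> S" for x
    using assms that by (auto simp: multiplicative_set_def)
  show "inverting_idempotent R S e s" if bc: "block_cond R S e s"
  proof -
    from bc have idem: "is_idempotent R e" and "R12 R e = {\<zero>}"
      and sub: "S \<subseteq> pmat_set R (Units (corner_ring R e)) {\<zero>} (R21 R e) (R22 R e)"
      and sS: "s \<in> S"
      and uv: "\<exists>u\<in>R11 R e. \<exists>v\<in>R21 R e. s = pmat R u \<zero> v \<zero>"
      by (auto simp: block_cond_def)
    note e = is_idempotentD[OF idem] and f = idempotent_complement[OF idem]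
    then have absorb: "e \<otimes> r \<otimes> e = e \<otimes> r" if "r \<in> carrier R" for r
      using R12_eq_zero_iff[OF idem] \<open>R12 R e = {\<zero>}\<close> that by blast
    have kill: "e \<otimes> c = \<zero>" if "c \<in> peirce R (\<one> \<ominus> e) g" "is_idempotent R g" for c g
    proof -
      have c: "c \<in> carrier R" "(\<one> \<ominus> e) \<otimes> c = c"
        using that mem_peirce_iff[OF f(1) that(2)] by auto
      have "e \<otimes> ((\<one> \<ominus> e) \<otimes> c) = (e \<otimes> (\<one> \<ominus> e)) \<otimes> c"
        using c(1) e(1) by (simp add: m_assoc)
      then show ?thesis using c f(2) by simp
    qed
    show ?thesis
    proof
      show "\<exists>y\<in>carrier R. e \<otimes> y = y \<and> y \<otimes> x = e \<and> e \<otimes> x \<otimes> y = e" if x: "x \<in> S" for x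
      proof -
        from x sub obtain a c d where a: "a \<in> Units (corner_ring R e)"
          and c: "c \<in> R21 R e" and d: "d \<in> R22 R e" and xeq: "x = a \<oplus> \<zero> \<oplus> c \<oplus> d"
          unfolding pmat_set_def pmat_def by blast
        from a obtain y where y: "y \<in> R11 R e" "y \<otimes> a = e" "a \<otimes> y = e" and a': "a \<in> R11 R e"
          using mem_Units_corner_iff[OF idem] by blast
        note pe = mem_peirce_iff[OF idem idem] mem_peirce_iff[OF f(1) idem]
          mem_peirce_iff[OF f(1) f(1)]
        have cl: "a \<in> carrier R" "c \<in> carrier R" "d \<in> carrier R" "y \<in> carrier R"
          using pe a' c d y by auto
        have "e \<otimes> x = e \<otimes> a \<oplus> e \<otimes> c \<oplus> e \<otimes> d"
          using cl e unfolding xeq by (simp add: r_distr)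
        then have ex: "e \<otimes> x = a"
          using kill[OF c idem] kill[OF d f(1)] a' pe cl by simp
        have "y \<otimes> x = y \<otimes> e \<otimes> x" using y pe by simp
        also have "\<dots> = y \<otimes> a" using ex cl e S[OF x] by (simp add: m_assoc)
        finally show ?thesis using y pe cl ex by auto
      qed
      from uv obtain u v where "u \<in> R11 R e" "v \<in> R21 R e" "s = u \<oplus> \<zero> \<oplus> v \<oplus> \<zero>"
        by (auto simp: pmat_def)
      then show "s \<otimes> e = s"
        using mem_peirce_iff[OF idem idem] mem_peirce_iff[OF f(1) idem] e
        by (auto simp: l_distr)
    qed (use assms idem absorb sS in auto)
  qed
  show "block_cond R S e s" if "inverting_idempotent R S e s"
  proof -
    interpret inverting_idempotent R S e s by fact
    note f = idempotent_complement[OF idem] and fc = is_idempotentD[OF idempotent_complement(1)[OF idem]]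
    note pe = mem_peirce_iff[OF idem idem] mem_peirce_iff[OF f(1) idem]
          mem_peirce_iff[OF f(1) f(1)]
    have split: "x = e \<otimes> x \<oplus> (\<one> \<ominus> e) \<otimes> x" if "x \<in> carrier R" for x
    proof -
      have "e \<otimes> x \<oplus> (\<one> \<ominus> e) \<otimes> x = (e \<oplus> (\<one> \<ominus> e)) \<otimes> x" using that fc by (simp add: l_distr)
      also have "e \<oplus> (\<one> \<ominus> e) = \<one>" by (simp add: minus_eq a_lcomm[of e \<one>] r_neg)
      finally show ?thesis using that by simp
    qed
    have split_r: "x = x \<otimes> e \<oplus> x \<otimes> (\<one> \<ominus> e)" if "x \<in> carrier R" for x
    proof -
      have "x \<otimes> e \<oplus> x \<otimes> (\<one> \<ominus> e) = x \<otimes> (e \<oplus> (\<one> \<ominus> e))" using that fc by (simp add: r_distr)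
      also have "e \<oplus> (\<one> \<ominus> e) = \<one>" by (simp add: minus_eq a_lcomm[of e \<one>] r_neg)
      finally show ?thesis using that by simp
    qed
    have ff: "(\<one> \<ominus> e) \<otimes> ((\<one> \<ominus> e) \<otimes> w) = (\<one> \<ominus> e) \<otimes> w" if "w \<in> carrier R" for w
      using that fc by (metis m_assoc)
    have "x \<in> pmat_set R (Units (corner_ring R e)) {\<zero>} (R21 R e) (R22 R e)" if x: "x \<in> S" for x
    proof -
      have xc: "x \<in> carrier R" using x by simp
      from inverse[OF x] obtain y where y: "y \<in> carrier R" "e \<otimes> y = y" "y \<otimes> x = e" "e \<otimes> x \<otimes> y = e"
        by blast
      have ye: "y \<otimes> e = y" using absorb[OF y(1)] y by simp
      have exe: "e \<otimes> (e \<otimes> x) = e \<otimes> x" using xc by (simp add: m_assoc[symmetric])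
      have "y \<otimes> (e \<otimes> x) = y \<otimes> e \<otimes> x" using y(1) xc by (simp add: m_assoc)
      then have "e \<otimes> x \<in> Units (corner_ring R e)"
        unfolding mem_Units_corner_iff[OF idem] Bex_def pe
        using y ye exe xc absorb[OF xc] by (intro conjI exI[of _ y]) auto
      moreover have "(\<one> \<ominus> e) \<otimes> x \<otimes> e \<in> R21 R e" "(\<one> \<ominus> e) \<otimes> x \<otimes> (\<one> \<ominus> e) \<in> R22 R e"
        using xc by (auto simp: peirce_def)
      moreover have "x = pmat R (e \<otimes> x) \<zero> ((\<one> \<ominus> e) \<otimes> x \<otimes> e) ((\<one> \<ominus> e) \<otimes> x \<otimes> (\<one> \<ominus> e))"
      proof -
        have "x = e \<otimes> x \<oplus> (\<one> \<ominus> e) \<otimes> x" by (rule split[OF xc])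
        also have "(\<one> \<ominus> e) \<otimes> x = (\<one> \<ominus> e) \<otimes> x \<otimes> e \<oplus> (\<one> \<ominus> e) \<otimes> x \<otimes> (\<one> \<ominus> e)"
          using split_r[of "(\<one> \<ominus> e) \<otimes> x"] fc xc by simp
        finally show ?thesis using fc xc by (simp add: pmat_def a_assoc)
      qed
      ultimately show ?thesis unfolding pmat_set_def by blast
    qed
    moreover have "e \<otimes> s \<in> R11 R e" "(\<one> \<ominus> e) \<otimes> s \<in> R21 R e"
      using s_e fc absorb[of s] ff[of s] unfolding pe by (auto simp: m_assoc) (metis e_closed e_e m_assoc s_closed)
    moreover have "s = pmat R (e \<otimes> s) \<zero> ((\<one> \<ominus> e) \<otimes> s) \<zero>"
      using split[of s] fc by (simp add: pmat_def)
    ultimately show ?thesis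
      using idem e_nonzero absorb s_in R12_eq_zero_iff[OF idem] unfolding block_cond_def by blast
  qed
qed

section \<open>Block conditions give denominator sets\<close>

context inverting_idempotent
begin

text \<open>An element of \<open>S\<close> acts invertibly on \<open>e R\<close>, so it annihilates nothing there. Together with the next
lemma this identifies \<open>ass S\<close> and the kernel of \<open>s\<close> with the same ideal \<open>{r. e r = 0}\<close>, which is why
the kernel is the same for every admissible \<open>s\<close>.\<close>

lemma annihilated_iff:
  assumes "x \<in> S" "r \<in> carrier R"
  shows "e \<otimes> x \<otimes> r = \<zero> \<longleftrightarrow> e \<otimes> r = \<zero>"
proof -
  obtain y where y: "y \<in> carrier R" "e \<otimes> y = y" "y \<otimes> x = e"
    using inverse[OF assms(1)] by blast
  have "y \<otimes> (e \<otimes> x \<otimes> r) = (y \<otimes> e) \<otimes> x \<otimes> r"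
    using assms y by (simp add: m_assoc)
  also have "y \<otimes> e = y"
    using absorb[OF y(1)] y by simp
  finally have 1: "y \<otimes> (e \<otimes> x \<otimes> r) = e \<otimes> r" using y by simp
  have "e \<otimes> x \<otimes> r = e \<otimes> x \<otimes> e \<otimes> r" using absorb[of x] assms by simp
  also have "\<dots> = e \<otimes> x \<otimes> (e \<otimes> r)" using assms by (simp add: m_assoc)
  finally show ?thesis using 1 assms y(1) by auto
qed

lemma s_kills_iff:
  assumes "r \<in> carrier R"
  shows "s \<otimes> r = \<zero> \<longleftrightarrow> e \<otimes> r = \<zero>"
proof
  assume "s \<otimes> r = \<zero>"
  then have "e \<otimes> s \<otimes> r = \<zero>" using assms by (simp add: m_assoc)
  then show "e \<otimes> r = \<zero>" using annihilated_iff[OF s_in assms] by simp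
next
  assume "e \<otimes> r = \<zero>"
  then have "s \<otimes> e \<otimes> r = \<zero>" using assms by (simp add: m_assoc)
  then show "s \<otimes> r = \<zero>" using s_e by simp
qed

lemma ass_eq_lmult_ker: "ass R S = lmult_ker R s"
proof -
  have "s \<otimes> r = \<zero>" if "x \<in> S" "r \<in> carrier R" "x \<otimes> r = \<zero>" for x r
  proof -
    have "e \<otimes> x \<otimes> r = \<zero>" using that by (simp add: m_assoc)
    then show ?thesis using annihilated_iff s_kills_iff that by blast
  qed
  then show ?thesis using s_in by (auto simp: ass_def lmult_ker_def)
qed

text \<open>The element \<open>s\<close> is a universal Ore multiplier: \<open>s r = (s r y) x\<close> where \<open>y\<close> inverts \<open>e x\<close>, and it is
also the universal witness for left reversibility.\<close>

lemma S_in_Den_l: "S \<in> Den_l R"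
proof -
  have "{t \<otimes> r | t. t \<in> S} \<inter> {q \<otimes> x | q. q \<in> carrier R} \<noteq> {}"
    if r: "r \<in> carrier R" and x: "x \<in> S" for r x
  proof -
    obtain y where y: "y \<in> carrier R" "e \<otimes> y = y" "y \<otimes> x = e"
      using inverse[OF x] by blast
    have "s \<otimes> r \<otimes> y \<otimes> x = s \<otimes> r \<otimes> e"
      using r x y by (simp add: m_assoc)
    also have "\<dots> = (s \<otimes> e) \<otimes> r \<otimes> e" using s_e by simp
    also have "\<dots> = s \<otimes> (e \<otimes> r \<otimes> e)" using r by (simp add: m_assoc)
    also have "\<dots> = s \<otimes> (e \<otimes> r)" using absorb[OF r] by simp
    also have "\<dots> = (s \<otimes> e) \<otimes> r" using r by (simp add: m_assoc)
    finally have "s \<otimes> r = (s \<otimes> r \<otimes> y) \<otimes> x" using s_e by simp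
    moreover have "s \<otimes> r \<otimes> y \<in> carrier R" using r y by simp
    ultimately show ?thesis using s_in by blast
  qed
  moreover have "\<exists>t\<in>S. t \<otimes> r = \<zero>"
    if r: "r \<in> carrier R" and x: "x \<in> S" and rx: "r \<otimes> x = \<zero>" for r x
  proof -
    obtain y where y: "y \<in> carrier R" "e \<otimes> y = y" "e \<otimes> x \<otimes> y = e"
      using inverse[OF x] by blast
    have "e \<otimes> r = e \<otimes> r \<otimes> e" using absorb[OF r] by simp
    also have "\<dots> = e \<otimes> r \<otimes> (e \<otimes> x \<otimes> y)" using y by simp
    also have "\<dots> = (e \<otimes> r \<otimes> e) \<otimes> x \<otimes> y" using r x y(1) by (simp add: m_assoc)
    also have "\<dots> = e \<otimes> (r \<otimes> x) \<otimes> y" using absorb[OF r] r x y(1) by (simp add: m_assoc)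
    finally have "e \<otimes> r = \<zero>" using rx y(1) by simp
    then show ?thesis using s_kills_iff[OF r] s_in by blast
  qed
  ultimately show ?thesis
    using mult_set by (auto simp: Den_l_def left_Ore_set_def)
qed

end

section \<open>The localization as a corner ring\<close>

context inverting_idempotent
begin

definition corner_inv :: "'a \<Rightarrow> 'a"
  where "corner_inv x = (SOME y. y \<in> carrier R \<and> e \<otimes> y = y \<and> y \<otimes> x = e \<and> e \<otimes> x \<otimes> y = e)"

lemma corner_inv:
  assumes "x \<in> S"
  shows "corner_inv x \<in> carrier R" "e \<otimes> corner_inv x = corner_inv x"
    "corner_inv x \<otimes> x = e" "e \<otimes> x \<otimes> corner_inv x = e" "corner_inv x \<otimes> e = corner_inv x"
proof -
  have "\<exists>y. y \<in> carrier R \<and> e \<otimes> y = y \<and> y \<otimes> x = e \<and> e \<otimes> x \<otimes> y = e"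
    using inverse[OF assms] by blast
  from someI_ex[OF this, folded corner_inv_def]
  show *: "corner_inv x \<in> carrier R" "e \<otimes> corner_inv x = corner_inv x"
    "corner_inv x \<otimes> x = e" "e \<otimes> x \<otimes> corner_inv x = e"
    by auto
  show "corner_inv x \<otimes> e = corner_inv x"
    using absorb[OF *(1)] * by simp
qed

text \<open>The homomorphism \<open>x \<mapsto> e x\<close> turns \<open>a t\<close> into \<open>(e a) (e t)\<close>, so \<open>(e a t)\<^sup>-\<^sup>1 (e a) = (e t)\<^sup>-\<^sup>1\<close> even though
\<open>a\<close> itself is not in \<open>S\<close>. This is the invariance of a fraction under expansion.\<close>

lemma corner_inv_cancel:
  assumes "t \<in> S" "a \<in> carrier R" "a \<otimes> t \<in> S"
  shows "corner_inv (a \<otimes> t) \<otimes> a = corner_inv t"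
proof -
  let ?w = "corner_inv (a \<otimes> t)" and ?y = "corner_inv t"
  note w = corner_inv[OF assms(3)] and y = corner_inv[OF assms(1)]
  have wa: "?w \<otimes> a \<otimes> e = ?w \<otimes> a"
    using absorb[of "?w \<otimes> a"] w assms by (simp add: m_assoc[symmetric])
  have "?w \<otimes> a = ?w \<otimes> a \<otimes> (e \<otimes> t \<otimes> ?y)" using wa y by simp
  also have "\<dots> = ?w \<otimes> a \<otimes> e \<otimes> t \<otimes> ?y"
    using w(1) y(1) assms by (simp add: m_assoc)
  also have "\<dots> = ?w \<otimes> (a \<otimes> t) \<otimes> ?y"
    unfolding wa using w(1) y(1) assms by (simp add: m_assoc)
  also have "\<dots> = ?y" using w(3) y(2) by simp
  finally show ?thesis .
qed

lemma corner_inv_mult: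
  assumes "t \<in> S" "x \<in> S"
  shows "corner_inv (t \<otimes> x) = corner_inv x \<otimes> corner_inv t"
proof -
  let ?w = "corner_inv (t \<otimes> x)"
  have tx: "t \<otimes> x \<in> S" using assms by (rule S_mult)
  note w = corner_inv[OF tx] and t = corner_inv[OF assms(1)]
  have "corner_inv x \<otimes> corner_inv t = ?w \<otimes> t \<otimes> corner_inv t"
    using corner_inv_cancel[OF assms(2) _ tx] assms by simp
  also have "\<dots> = (?w \<otimes> e) \<otimes> t \<otimes> corner_inv t" using w by simp
  also have "\<dots> = ?w \<otimes> (e \<otimes> t \<otimes> corner_inv t)" using w(1) t(1) assms by (simp add: m_assoc)
  finally show ?thesis using w t by simp
qed

lemma corner_inv_one: "corner_inv \<one> = e"
  using corner_inv[OF S_one] by simp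

text \<open>The representatives \<open>(t, r)\<close> of the fraction whose value \<open>(e t)\<^sup>-\<^sup>1 e r\<close> in \<open>e R e\<close> is \<open>z\<close>. The lemmas
below show that \<open>z \<mapsto> fracs z\<close> carries the multiplication of \<open>e R e\<close> to that of the localization.\<close>

definition fracs :: "'a \<Rightarrow> ('a \<times> 'a) set"
  where "fracs z = {(t, r). t \<in> S \<and> r \<in> carrier R \<and> corner_inv t \<otimes> r = z}"

text \<open>Two fractions are identified iff their values in \<open>e R e\<close> agree. If they agree, then
\<open>s (e t)\<^sup>-\<^sup>1\<close> and \<open>s (e t')\<^sup>-\<^sup>1\<close> are multipliers that bring both to the common denominator \<open>s\<close>.\<close>

lemma frac_rel_iff:
  "((t, r), (t', r')) \<in> frac_rel R S \<longleftrightarrow>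
    t \<in> S \<and> r \<in> carrier R \<and> t' \<in> S \<and> r' \<in> carrier R \<and> corner_inv t \<otimes> r = corner_inv t' \<otimes> r'"
    (is "?L \<longleftrightarrow> ?R")
proof
  assume ?L
  then obtain a b where *: "t \<in> S" "r \<in> carrier R" "t' \<in> S" "r' \<in> carrier R"
    "a \<in> carrier R" "b \<in> carrier R" "a \<otimes> t = b \<otimes> t'" "a \<otimes> t \<in> S" "a \<otimes> r = b \<otimes> r'"
    by (auto simp: frac_rel_def)
  note w = corner_inv(1)[OF *(8)]
  have "corner_inv t \<otimes> r = corner_inv (a \<otimes> t) \<otimes> (a \<otimes> r)"
    using corner_inv_cancel[OF *(1,5,8)] w *(2,5) by (simp add: m_assoc[symmetric])
  also have "\<dots> = corner_inv (a \<otimes> t) \<otimes> b \<otimes> r'"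
    unfolding *(9) using w *(4,6) by (simp add: m_assoc)
  also have "\<dots> = corner_inv t' \<otimes> r'"
    using corner_inv_cancel[OF *(3,6)] *(7,8) by simp
  finally show ?R using * by simp
next
  assume *: ?R
  then have t: "t \<in> S" "t' \<in> S" and r: "r \<in> carrier R" "r' \<in> carrier R" by auto
  note t1 = corner_inv[OF t(1)] and t2 = corner_inv[OF t(2)]
  let ?a = "s \<otimes> corner_inv t" and ?b = "s \<otimes> corner_inv t'"
  have "?a \<otimes> t = s" "?b \<otimes> t' = s"
    using t1 t2 t s_e by (simp_all add: m_assoc)
  moreover have "?a \<otimes> r = ?b \<otimes> r'"
    using t1 t2 r * by (simp add: m_assoc)
  ultimately show ?L
    unfolding frac_rel_def using t r t1(1) t2(1) s_in
    by (intro CollectI exI[of _ t] exI[of _ r] exI[of _ t'] exI[of _ r'] conjI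
        bexI[of _ ?a] bexI[of _ ?b]) auto
qed

lemma ofrac_eq:
  assumes "t \<in> S" "r \<in> carrier R"
  shows "ofrac R S t r = fracs (corner_inv t \<otimes> r)"
  using assms by (auto simp: ofrac_def frac_rel_iff fracs_def)

lemma mem_fracs_one:
  assumes "z \<in> carrier R" "e \<otimes> z = z"
  shows "(\<one>, z) \<in> fracs z"
  using assms S_one by (simp add: fracs_def corner_inv_one)

lemma fracs_eq_iff:
  assumes "z \<in> carrier R" "e \<otimes> z = z"
  shows "fracs z = fracs w \<longleftrightarrow> z = w"
  using mem_fracs_one[OF assms] by (auto simp: fracs_def)

text \<open>The product is a union over all Ore multipliers. All of them give the value \<open>z w\<close>, and the
multipliers \<open>1\<close> and \<open>z\<close> for the representatives \<open>(1, z)\<close> and \<open>(1, w)\<close> show that the union is not empty.\<close>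

lemma frac_mult_fracs:
  assumes z: "z \<in> carrier R" "e \<otimes> z = z" and w: "w \<in> carrier R" "e \<otimes> w = w"
  shows "frac_mult R S (fracs z) (fracs w) = fracs (z \<otimes> w)"
proof
  have key: "corner_inv (t \<otimes> x) \<otimes> (a \<otimes> r') = z \<otimes> w"
    if h: "(x, r) \<in> fracs z" "(x', r') \<in> fracs w" "a \<in> carrier R" "t \<in> S" "t \<otimes> r = a \<otimes> x'"
    for x r x' r' a t
  proof -
    from h have S: "x \<in> S" "x' \<in> S" "t \<in> S" and c: "r \<in> carrier R" "r' \<in> carrier R" "a \<in> carrier R"
      and zw: "corner_inv x \<otimes> r = z" "corner_inv x' \<otimes> r' = w"
      by (auto simp: fracs_def)
    note t = corner_inv[OF S(3)] and x = corner_inv[OF S(1)] and x' = corner_inv[OF S(2)]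
    have ta: "corner_inv t \<otimes> a \<otimes> e = corner_inv t \<otimes> a"
      using absorb[of "corner_inv t \<otimes> a"] t c by (simp add: m_assoc[symmetric])
    \<comment> \<open>\<open>t r = a x'\<close> becomes \<open>(e t)\<^sup>-\<^sup>1 a = e r (e x')\<^sup>-\<^sup>1\<close>.\<close>
    have "corner_inv t \<otimes> a = corner_inv t \<otimes> a \<otimes> (e \<otimes> x' \<otimes> corner_inv x')"
      using ta x' by simp
    also have "\<dots> = corner_inv t \<otimes> a \<otimes> e \<otimes> x' \<otimes> corner_inv x'"
      using t(1) x'(1) c S by (simp add: m_assoc)
    also have "\<dots> = corner_inv t \<otimes> (a \<otimes> x') \<otimes> corner_inv x'"
      unfolding ta using t(1) x'(1) c S by (simp add: m_assoc)
    also have "\<dots> = corner_inv t \<otimes> t \<otimes> r \<otimes> corner_inv x'"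
      using h(5)[symmetric] t(1) x'(1) c S by (simp add: m_assoc)
    finally have 1: "corner_inv t \<otimes> a = e \<otimes> r \<otimes> corner_inv x'" using t by simp
    have "corner_inv (t \<otimes> x) \<otimes> (a \<otimes> r') = corner_inv x \<otimes> (corner_inv t \<otimes> a) \<otimes> r'"
      unfolding corner_inv_mult[OF S(3,1)] using t(1) x(1) c by (simp add: m_assoc)
    also have "\<dots> = corner_inv x \<otimes> e \<otimes> r \<otimes> (corner_inv x' \<otimes> r')"
      unfolding 1 using x(1) x'(1) c by (simp add: m_assoc)
    finally show ?thesis using x zw by simp
  qed
  show "frac_mult R S (fracs z) (fracs w) \<subseteq> fracs (z \<otimes> w)"
  proof
    fix p assume "p \<in> frac_mult R S (fracs z) (fracs w)"
    then obtain x r x' r' a t where h: "p \<in> ofrac R S (t \<otimes> x) (a \<otimes> r')"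
      "(x, r) \<in> fracs z" "(x', r') \<in> fracs w" "a \<in> carrier R" "t \<in> S" "t \<otimes> r = a \<otimes> x'"
      unfolding frac_mult_def by blast
    then have "t \<otimes> x \<in> S" "a \<otimes> r' \<in> carrier R" by (auto simp: fracs_def intro: S_mult)
    from ofrac_eq[OF this] show "p \<in> fracs (z \<otimes> w)"
      using h(1) key[OF h(2-)] by simp
  qed
  show "fracs (z \<otimes> w) \<subseteq> frac_mult R S (fracs z) (fracs w)"
  proof
    fix p assume "p \<in> fracs (z \<otimes> w)"
    moreover have "e \<otimes> (z \<otimes> w) = z \<otimes> w" using z w by (simp add: m_assoc[symmetric])
    ultimately have "p \<in> ofrac R S (\<one> \<otimes> \<one>) (z \<otimes> w)"
      using ofrac_eq[OF S_one, of "z \<otimes> w"] z w by (simp add: corner_inv_one)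
    then show "p \<in> frac_mult R S (fracs z) (fracs w)"
      unfolding frac_mult_def using mem_fracs_one[OF z] mem_fracs_one[OF w] S_one z
      by (intro CollectI exI[of _ \<one>] exI[of _ z] exI[of _ w] conjI) auto
  qed
qed

lemma loc_map_eq: "x \<in> carrier R \<Longrightarrow> loc_map R S x = fracs (e \<otimes> x)"
  using ofrac_eq[OF S_one] by (simp add: loc_map_def corner_inv_one)

lemma carrier_left_localization:
  "carrier (left_localization R S) = fracs ` {z \<in> carrier R. e \<otimes> z = z}"
proof -
  have "carrier (left_localization R S) = (\<lambda>(t, r). ofrac R S t r) ` (S \<times> carrier R)"
    by (auto simp: left_localization_def quotient_def ofrac_def)
  also have "\<dots> = fracs ` {z \<in> carrier R. e \<otimes> z = z}"
  proof (intro equalityI subsetI)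
    fix P assume "P \<in> (\<lambda>(t, r). ofrac R S t r) ` (S \<times> carrier R)"
    then obtain t r where tr: "t \<in> S" "r \<in> carrier R" "P = ofrac R S t r" by auto
    then have "P = fracs (corner_inv t \<otimes> r)" using ofrac_eq by simp
    moreover have "e \<otimes> (corner_inv t \<otimes> r) = corner_inv t \<otimes> r"
      using corner_inv[OF tr(1)] tr by (simp add: m_assoc[symmetric])
    ultimately show "P \<in> fracs ` {z \<in> carrier R. e \<otimes> z = z}"
      using corner_inv(1)[OF tr(1)] tr by blast
  next
    fix P assume "P \<in> fracs ` {z \<in> carrier R. e \<otimes> z = z}"
    then obtain z where z: "z \<in> carrier R" "e \<otimes> z = z" "P = fracs z" by auto
    then have "P = ofrac R S \<one> z" using ofrac_eq[OF S_one] by (simp add: corner_inv_one)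
    then show "P \<in> (\<lambda>(t, r). ofrac R S t r) ` (S \<times> carrier R)" using z S_one by force
  qed
  finally show ?thesis .
qed

text \<open>The localization is a copy of the monoid \<open>e R e\<close>, and the image of \<open>x\<close> corresponds to \<open>e x\<close>.\<close>

lemma loc_map_unit_iff:
  assumes x: "x \<in> carrier R"
  shows "loc_map R S x \<in> Units (left_localization R S) \<longleftrightarrow>
    (\<exists>y\<in>carrier R. e \<otimes> y = y \<and> y \<otimes> x = e \<and> e \<otimes> x \<otimes> y = e)"
proof -
  let ?E = "{z \<in> carrier R. e \<otimes> z = z}"
  have ex: "e \<otimes> x \<in> carrier R" "e \<otimes> (e \<otimes> x) = e \<otimes> x"
    using x by (simp_all add: m_assoc[symmetric])
  have one: "\<one>\<^bsub>left_localization R S\<^esub> = fracs e"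
    using ofrac_eq[OF S_one] by (simp add: left_localization_def corner_inv_one)
  have mult: "P \<otimes>\<^bsub>left_localization R S\<^esub> Q = frac_mult R S P Q" for P Q
    by (simp add: left_localization_def)
  have eq_e: "fracs z = fracs e \<longleftrightarrow> z = e" for z
    using fracs_eq_iff[of e z] by auto
  have "loc_map R S x \<in> Units (left_localization R S) \<longleftrightarrow>
     (\<exists>y\<in>?E. frac_mult R S (fracs y) (fracs (e \<otimes> x)) = fracs e \<and>
             frac_mult R S (fracs (e \<otimes> x)) (fracs y) = fracs e)"
    unfolding Units_def using ex
    by (auto simp: one mult carrier_left_localization loc_map_eq[OF x])
  also have "\<dots> \<longleftrightarrow> (\<exists>y\<in>?E. y \<otimes> (e \<otimes> x) = e \<and> e \<otimes> x \<otimes> y = e)"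
    using ex by (intro bex_cong) (auto simp: frac_mult_fracs eq_e)
  also have "\<dots> \<longleftrightarrow> (\<exists>y\<in>?E. y \<otimes> x = e \<and> e \<otimes> x \<otimes> y = e)"
  proof (intro bex_cong refl)
    fix y assume "y \<in> ?E"
    then have "y \<otimes> (e \<otimes> x) = y \<otimes> x"
      using absorb[of y] x by (simp add: m_assoc[symmetric])
    then show "y \<otimes> (e \<otimes> x) = e \<and> e \<otimes> x \<otimes> y = e \<longleftrightarrow> y \<otimes> x = e \<and> e \<otimes> x \<otimes> y = e" by simp
  qed
  finally show ?thesis by auto
qed

end

section \<open>Denominator sets of left Artinian rings\<close>

lemma (in ring) left_idealI:
  assumes "L \<subseteq> carrier R" "\<zero> \<in> L"
    and "\<And>x y. x \<in> L \<Longrightarrow> y \<in> L \<Longrightarrow> x \<oplus> y \<in> L"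
    and "\<And>r x. r \<in> carrier R \<Longrightarrow> x \<in> L \<Longrightarrow> r \<otimes> x \<in> L"
  shows "left_ideal R L"
proof -
  have "\<ominus> x \<in> L" if "x \<in> L" for x
  proof -
    have "\<ominus> x = (\<ominus> \<one>) \<otimes> x" using assms(1) that by (simp add: l_minus subsetD)
    then show ?thesis using assms(4)[of "\<ominus> \<one>" x] that by simp
  qed
  then have "subgroup L (add_monoid R)"
    using assms by (intro add.subgroupI) (auto simp: a_inv_def)
  then show ?thesis using assms(4) by (simp add: left_ideal_def additive_subgroup_def)
qed

lemma (in ring) left_idealD:
  assumes "left_ideal R L"
  shows "L \<subseteq> carrier R" "\<zero> \<in> L"
    and "\<And>x y. x \<in> L \<Longrightarrow> y \<in> L \<Longrightarrow> x \<oplus> y \<in> L"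
    and "\<And>x y. x \<in> L \<Longrightarrow> y \<in> L \<Longrightarrow> x \<ominus> y \<in> L"
    and "\<And>r x. r \<in> carrier R \<Longrightarrow> x \<in> L \<Longrightarrow> r \<otimes> x \<in> L"
proof -
  interpret additive_subgroup L R using assms by (simp add: left_ideal_def)
  show "L \<subseteq> carrier R" "\<zero> \<in> L"
    and add: "\<And>x y. x \<in> L \<Longrightarrow> y \<in> L \<Longrightarrow> x \<oplus> y \<in> L"
    by (auto simp: a_subset[THEN subsetD])
  show m: "\<And>r x. r \<in> carrier R \<Longrightarrow> x \<in> L \<Longrightarrow> r \<otimes> x \<in> L"
    using assms by (simp add: left_ideal_def)
  show "x \<ominus> y \<in> L" if "x \<in> L" "y \<in> L" for x y
    using add[OF that(1) a_inv_closed[OF that(2)]] by (simp add: minus_eq)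
qed

lemma (in ring) left_ideal_principal:
  assumes x: "x \<in> carrier R"
  shows "left_ideal R {r \<otimes> x | r. r \<in> carrier R}"
proof (rule left_idealI)
  show "\<zero> \<in> {r \<otimes> x | r. r \<in> carrier R}"
    using x by (auto intro!: exI[of _ \<zero>])
  show "a \<oplus> b \<in> {r \<otimes> x | r. r \<in> carrier R}"
    if ab: "a \<in> {r \<otimes> x | r. r \<in> carrier R}" "b \<in> {r \<otimes> x | r. r \<in> carrier R}" for a b
  proof -
    from ab obtain p q where "p \<in> carrier R" "q \<in> carrier R" "a = p \<otimes> x" "b = q \<otimes> x" by blast
    then have "a \<oplus> b = (p \<oplus> q) \<otimes> x" "p \<oplus> q \<in> carrier R" using x by (simp_all add: l_distr)
    then show ?thesis by blast
  qed
  show "q \<otimes> a \<in> {r \<otimes> x | r. r \<in> carrier R}"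
    if q: "q \<in> carrier R" and a: "a \<in> {r \<otimes> x | r. r \<in> carrier R}" for q a
  proof -
    from a obtain p where "p \<in> carrier R" "a = p \<otimes> x" by blast
    then have "q \<otimes> a = (q \<otimes> p) \<otimes> x" "q \<otimes> p \<in> carrier R" using q x by (simp_all add: m_assoc)
    then show ?thesis by blast
  qed
qed (use x in auto)

lemma (in ring) Den_lD:
  assumes "S \<in> Den_l R"
  shows "multiplicative_set R S"
    and "\<And>r x. r \<in> carrier R \<Longrightarrow> x \<in> S \<Longrightarrow> \<exists>t\<in>S. \<exists>q\<in>carrier R. t \<otimes> r = q \<otimes> x"
    and "\<And>r x. r \<in> carrier R \<Longrightarrow> x \<in> S \<Longrightarrow> r \<otimes> x = \<zero> \<Longrightarrow> \<exists>t\<in>S. t \<otimes> r = \<zero>"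
proof -
  show "\<exists>t\<in>S. \<exists>q\<in>carrier R. t \<otimes> r = q \<otimes> x" if "r \<in> carrier R" "x \<in> S" for r x
  proof -
    have "{t \<otimes> r | t. t \<in> S} \<inter> {q \<otimes> x | q. q \<in> carrier R} \<noteq> {}"
      using assms that unfolding Den_l_def left_Ore_set_def by blast
    then show ?thesis by auto
  qed
qed (use assms in \<open>auto simp: Den_l_def left_Ore_set_def\<close>)

text \<open>The Ore condition makes the left ideals
\<open>R t\<close> with \<open>t \<in> S\<close> downward directed, because \<open>t' x = q t\<close> lies in \<open>S\<close>, in \<open>R x\<close> and in \<open>R t\<close>. A minimal
member is therefore a least one.\<close>

lemma (in ring) ex_common_right_divisor:
  assumes art: "left_artinian R" and Den: "S \<in> Den_l R"
  shows "\<exists>s\<in>S. \<forall>t\<in>S. \<exists>q\<in>carrier R. s = q \<otimes> t"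
proof (rule ccontr)
  assume neg: "\<not> ?thesis"
  let ?P = "\<lambda>x. {r \<otimes> x | r. r \<in> carrier R}"
  note D = Den_lD[OF Den]
  have S: "x \<in> carrier R" if "x \<in> S" for x
    using D(1) that by (auto simp: multiplicative_set_def)
  have "\<exists>u\<in>S. ?P u \<subset> ?P x" if x: "x \<in> S" for x
  proof -
    have "\<not> (\<forall>t\<in>S. \<exists>q\<in>carrier R. x = q \<otimes> t)"
      using neg x by (meson bexI)
    then obtain t where t: "t \<in> S" "\<forall>q\<in>carrier R. x \<noteq> q \<otimes> t" by meson
    obtain t' q where q: "t' \<in> S" "q \<in> carrier R" "t' \<otimes> x = q \<otimes> t"
      using D(2)[OF S[OF x] t(1)] by blast
    \<comment> \<open>If \<open>x\<close> is not in \<open>R t\<close>, the common multiple \<open>t' x = q t\<close> generates a strictly smaller left ideal.\<close>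
    have "?P (t' \<otimes> x) \<subseteq> ?P x"
    proof
      fix z assume "z \<in> ?P (t' \<otimes> x)"
      then obtain r where "r \<in> carrier R" "z = r \<otimes> (t' \<otimes> x)" by blast
      then have "z = (r \<otimes> t') \<otimes> x" "r \<otimes> t' \<in> carrier R"
        using S[OF x] S[OF q(1)] by (simp_all add: m_assoc)
      then show "z \<in> ?P x" by blast
    qed
    moreover have "x \<notin> ?P (t' \<otimes> x)"
    proof
      assume "x \<in> ?P (t' \<otimes> x)"
      then obtain r where r: "r \<in> carrier R" "x = r \<otimes> (q \<otimes> t)" using q(3) by auto
      then have "x = (r \<otimes> q) \<otimes> t" using q(2) S[OF t(1)] by (simp add: m_assoc)
      then show False using t(2) r(1) q(2) by blast
    qed
    moreover have "x \<in> ?P x" using S[OF x] by (intro CollectI exI[of _ \<one>]) simp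
    moreover have "t' \<otimes> x \<in> S" using D(1) q(1) x by (simp add: multiplicative_set_def)
    ultimately show ?thesis by blast
  qed
  moreover define P where "P x = ?P x" for x
  ultimately have "\<forall>x\<in>S. \<exists>u. u \<in> S \<and> P u \<subset> P x" by (simp add: Bex_def)
  from bchoice[OF this] obtain f where f: "\<And>x. x \<in> S \<Longrightarrow> f x \<in> S \<and> P (f x) \<subset> P x" by blast
  define g where "g n = (f ^^ n) \<one>" for n
  have gS: "g n \<in> S" for n
    using D(1) f by (induction n) (auto simp: g_def multiplicative_set_def)
  have strict: "P (g (Suc n)) \<subset> P (g n)" for n
    using f[OF gS] by (simp add: g_def)
  have "left_ideal R (P (g n))" for n
    using left_ideal_principal[OF S[OF gS]] by (simp add: P_def)
  then have "\<forall>n. left_ideal R (P (g n)) \<and> P (g (Suc n)) \<subseteq> P (g n)"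
    using strict by (simp add: psubset_imp_subset)
  with art have "\<exists>n. \<forall>m\<ge>n. P (g m) = P (g n)"
    unfolding left_artinian_def by (elim allE[of _ "\<lambda>n. P (g n)"]) blast
  then obtain n where "P (g (Suc n)) = P (g n)" by (meson le_SucI order_refl)
  then show False using strict[of n] by blast
qed

text \<open>Let \<open>s\<close> generate the least left ideal \<open>R t\<close> with \<open>t \<in> S\<close>. Then everything that is killed from either
side by some element of \<open>S\<close> is killed by \<open>s\<close> on the left, and \<open>{r. s r = 0}\<close> is closed under left
multiplication. For \<open>t \<in> S\<close> leastness gives \<open>s = q t s\<close>, that is \<open>(1 - q t) s = 0\<close>, and reversibility
moves \<open>s\<close> to the other side: \<open>s q t = s\<close>. For \<open>t = s\<close> this is von Neumann regularity \<open>s p s = s\<close>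
and yields the idempotent \<open>e = p s\<close>, with the same right annihilator as \<open>s\<close>; for general \<open>t\<close>
it yields the left inverse \<open>e q\<close> of \<open>e t\<close>.\<close>

lemma (in ring) Den_l_imp_inverting_idempotent:
  assumes art: "left_artinian R" and Den: "S \<in> Den_l R"
  shows "\<exists>e s. inverting_idempotent R S e s"
proof -
  note D = Den_lD[OF Den]
  have S: "x \<in> carrier R" if "x \<in> S" for x
    using D(1) that by (auto simp: multiplicative_set_def)
  have SS: "x \<otimes> y \<in> S" if "x \<in> S" "y \<in> S" for x y
    using D(1) that by (auto simp: multiplicative_set_def)
  obtain s where s: "s \<in> S" and least: "\<And>t. t \<in> S \<Longrightarrow> \<exists>q\<in>carrier R. s = q \<otimes> t"
    using ex_common_right_divisor[OF art Den] by blast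
  note sc = S[OF s]
  have kill: "s \<otimes> r = \<zero>" if t: "t \<in> S" and r: "r \<in> carrier R" "t \<otimes> r = \<zero>" for t r
  proof -
    obtain q where "q \<in> carrier R" "s = q \<otimes> t" using least[OF t] by blast
    then show ?thesis using r S[OF t] by (simp add: m_assoc)
  qed
  have kill_right: "s \<otimes> r = \<zero>" if "x \<in> S" "r \<in> carrier R" "r \<otimes> x = \<zero>" for x r
    using D(3)[OF that(2,1,3)] kill that by blast
  have kill_mult: "s \<otimes> (r \<otimes> z) = \<zero>" if r: "r \<in> carrier R" and z: "z \<in> carrier R" "s \<otimes> z = \<zero>" for r z
  proof -
    obtain t q where tq: "t \<in> S" "q \<in> carrier R" "t \<otimes> r = q \<otimes> s" using D(2)[OF r s] by blast
    have "t \<otimes> (r \<otimes> z) = q \<otimes> (s \<otimes> z)"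
      using tq r z(1) S[OF tq(1)] sc by (simp add: m_assoc[symmetric])
    then show ?thesis using kill[OF tq(1)] tq r z by simp
  qed
  have regular: "\<exists>q\<in>carrier R. s \<otimes> q \<otimes> t = s" if t: "t \<in> S" for t
  proof -
    obtain q where q: "q \<in> carrier R" "s = q \<otimes> (t \<otimes> s)" using least[OF SS[OF t s]] by blast
    note tc = S[OF t]
    have "(\<one> \<ominus> q \<otimes> t) \<otimes> s = s \<ominus> q \<otimes> (t \<otimes> s)"
      using q(1) tc sc by (simp add: minus_eq l_distr l_minus m_assoc)
    also have "\<dots> = \<zero>" using q(2)[symmetric] sc by (simp add: r_neg minus_eq)
    finally have "s \<otimes> (\<one> \<ominus> q \<otimes> t) = \<zero>" using kill_right[OF s] q(1) tc by simp
    then have "s \<ominus> s \<otimes> q \<otimes> t = \<zero>"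
      using q(1) tc sc by (simp add: minus_eq r_distr r_minus m_assoc)
    then show ?thesis using q(1) tc sc by (intro bexI[of _ q]) auto
  qed
  obtain p where p: "p \<in> carrier R" "s \<otimes> p \<otimes> s = s" using regular[OF s] by blast
  define e where "e = p \<otimes> s"
  have ec: "e \<in> carrier R" using p sc by (simp add: e_def)
  have se: "s \<otimes> e = s" using p sc by (simp add: e_def m_assoc)
  have ee: "e \<otimes> e = e"
  proof -
    have "e \<otimes> e = p \<otimes> (s \<otimes> e)" using p sc ec by (simp add: e_def m_assoc)
    then show ?thesis using se by (simp add: e_def)
  qed
  have absorb: "e \<otimes> r \<otimes> e = e \<otimes> r" if r: "r \<in> carrier R" for r
  proof -
    have "s \<otimes> (\<one> \<ominus> e) = \<zero>" using se ec sc by (simp add: minus_eq r_distr r_minus r_neg)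
    then have "s \<otimes> (r \<otimes> (\<one> \<ominus> e)) = \<zero>" using kill_mult r ec by simp
    then have "e \<otimes> (r \<otimes> (\<one> \<ominus> e)) = \<zero>" using p sc r ec by (simp add: e_def m_assoc)
    then have "e \<otimes> r \<ominus> e \<otimes> r \<otimes> e = \<zero>" using r ec by (simp add: minus_eq r_distr r_minus m_assoc)
    then show ?thesis using r ec by simp
  qed
  have "\<exists>y\<in>carrier R. e \<otimes> y = y \<and> y \<otimes> x = e \<and> e \<otimes> x \<otimes> y = e" if x: "x \<in> S" for x
  proof -
    note xc = S[OF x]
    obtain q where q: "q \<in> carrier R" "s \<otimes> q \<otimes> x = s" using regular[OF x] by blast
    define y where "y = e \<otimes> q"
    have yc: "y \<in> carrier R" using q ec by (simp add: y_def)
    have yx: "y \<otimes> x = e"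
    proof -
      have "y \<otimes> x = p \<otimes> (s \<otimes> q \<otimes> x)" using q(1) xc p sc by (simp add: y_def e_def m_assoc)
      then show ?thesis using q by (simp add: e_def)
    qed
    have ey: "e \<otimes> y = y" using q ec ee by (simp add: y_def m_assoc[symmetric])
    \<comment> \<open>The left inverse is two-sided: the defect \<open>w\<close> of the other product satisfies \<open>w x = 0\<close>, so \<open>s w = 0\<close>.\<close>
    define w where "w = e \<otimes> x \<otimes> y \<ominus> e"
    have wc: "w \<in> carrier R" using ec xc yc by (simp add: w_def)
    have "w \<otimes> x = e \<otimes> x \<otimes> (y \<otimes> x) \<ominus> e \<otimes> x"
      using ec xc yc by (simp add: w_def minus_eq l_distr l_minus m_assoc)
    then have "w \<otimes> x = \<zero>" using yx absorb[OF xc] ec xc by (simp add: r_neg minus_eq)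
    then have "s \<otimes> w = \<zero>" using kill_right[OF x wc] by simp
    then have "e \<otimes> w = \<zero>" using p sc wc by (simp add: e_def m_assoc)
    moreover have "e \<otimes> w = w"
      using ec xc yc ee by (simp add: w_def minus_eq r_distr r_minus m_assoc[symmetric])
    ultimately have "w = \<zero>" by simp
    then have "e \<otimes> x \<otimes> y = e"
      using r_right_minus_eq[of "e \<otimes> x \<otimes> y" e] ec xc yc by (simp add: w_def)
    then show ?thesis using yc ey yx by blast
  qed
  then have "inverting_idempotent R S e s"
    using D(1) ec ee absorb s se by unfold_locales (auto simp: is_idempotent_def)
  then show ?thesis by blast
qed

section \<open>The Jacobson radical\<close>

context ring
begin

lemma maximal_left_idealD:
  assumes "maximal_left_ideal R M"
  shows "left_ideal R M" "\<one> \<notin> M"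
    and "\<And>L. left_ideal R L \<Longrightarrow> M \<subseteq> L \<Longrightarrow> L = M \<or> L = carrier R"
proof -
  show L: "left_ideal R M" and "\<And>L. left_ideal R L \<Longrightarrow> M \<subseteq> L \<Longrightarrow> L = M \<or> L = carrier R"
    using assms by (auto simp: maximal_left_ideal_def)
  show "\<one> \<notin> M"
  proof
    assume "\<one> \<in> M"
    then have "r \<in> M" if "r \<in> carrier R" for r
      using left_idealD(5)[OF L that] that by force
    then show False using assms left_idealD(1)[OF L] by (auto simp: maximal_left_ideal_def)
  qed
qed

lemma maximal_left_idealI:
  assumes L: "left_ideal R M" and one: "\<one> \<notin> M"
    and max: "\<And>K. left_ideal R K \<Longrightarrow> M \<subseteq> K \<Longrightarrow> \<one> \<notin> K \<Longrightarrow> K = M"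
  shows "maximal_left_ideal R M"
proof -
  have "K = carrier R" if K: "left_ideal R K" and "\<one> \<in> K" for K
    using left_idealD(1)[OF K] left_idealD(5)[OF K _ \<open>\<one> \<in> K\<close>] by force
  then show ?thesis
    using L one max unfolding maximal_left_ideal_def by blast
qed

text \<open>Zorn's lemma: a union of a chain of left ideals that omit \<open>1\<close> omits \<open>1\<close>.\<close>

lemma ex_maximal_left_ideal:
  assumes L: "left_ideal R L" and one: "\<one> \<notin> L"
  shows "\<exists>M. maximal_left_ideal R M \<and> L \<subseteq> M"
proof -
  let ?A = "{K. left_ideal R K \<and> L \<subseteq> K \<and> \<one> \<notin> K}"
  have "\<exists>M\<in>?A. \<forall>K\<in>?A. M \<subseteq> K \<longrightarrow> K = M"
  proof (rule subset_Zorn_nonempty)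
    show "?A \<noteq> {}" using L one by blast
    fix C assume ne: "C \<noteq> {}" and ch: "subset.chain ?A C"
    then have C: "left_ideal R K" "L \<subseteq> K" "\<one> \<notin> K" if "K \<in> C" for K
      using that by (auto simp: subset_chain_def)
    have "left_ideal R (\<Union> C)"
    proof (rule left_idealI)
      show "\<Union> C \<subseteq> carrier R" using C(1) left_idealD(1) by blast
      show "\<zero> \<in> \<Union> C" using ne C(1) left_idealD(2) by blast
      show "r \<otimes> x \<in> \<Union> C" if "r \<in> carrier R" "x \<in> \<Union> C" for r x
        using that C(1) left_idealD(5) by blast
      show "x \<oplus> y \<in> \<Union> C" if xy: "x \<in> \<Union> C" "y \<in> \<Union> C" for x y
      proof -
        from xy obtain K N where "K \<in> C" "x \<in> K" "N \<in> C" "y \<in> N" by blast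
        moreover from this have "K \<subseteq> N \<or> N \<subseteq> K" using ch by (auto simp: subset_chain_def)
        ultimately obtain P where "P \<in> C" "x \<in> P" "y \<in> P" by blast
        then show ?thesis using C(1) left_idealD(3) by blast
      qed
    qed
    moreover have "L \<subseteq> \<Union> C"
    proof -
      from ne obtain K where "K \<in> C" by blast
      then show ?thesis using C(2)[of K] by blast
    qed
    moreover have "\<one> \<notin> \<Union> C" using C(3) by blast
    ultimately show "\<Union> C \<in> ?A" by simp
  qed
  then obtain M where M: "left_ideal R M" "L \<subseteq> M" "\<one> \<notin> M"
    and max: "\<forall>K\<in>?A. M \<subseteq> K \<longrightarrow> K = M" by auto
  have "maximal_left_ideal R M"
  proof (rule maximal_left_idealI)
    show "K = M" if "left_ideal R K" "M \<subseteq> K" "\<one> \<notin> K" for K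
    proof -
      have "K \<in> ?A" using that M(2) by simp
      then show ?thesis using max that(2) by blast
    qed
  qed (use M in auto)
  then show ?thesis using M(2) by blast
qed

lemma maximal_left_ideal_complement:
  assumes max: "maximal_left_ideal R M" and x: "x \<in> carrier R" "x \<notin> M"
  shows "\<exists>m\<in>M. \<exists>y\<in>carrier R. \<one> = m \<oplus> y \<otimes> x"
proof -
  note M = maximal_left_idealD[OF max]
  note L = left_idealD[OF M(1)]
  have Mc: "m \<in> carrier R" if "m \<in> M" for m using L(1) that by blast
  let ?K = "{m \<oplus> y \<otimes> x | m y. m \<in> M \<and> y \<in> carrier R}"
  have memK: "z \<in> ?K" if "m \<in> M" "y \<in> carrier R" "z = m \<oplus> y \<otimes> x" for z m y
    using that by blast
  have "left_ideal R ?K"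
  proof (rule left_idealI)
    show "?K \<subseteq> carrier R" using x Mc by auto
    show "\<zero> \<in> ?K" using memK[OF L(2), of \<zero>] x by simp
    show "a \<oplus> b \<in> ?K" if ab: "a \<in> ?K" "b \<in> ?K" for a b
    proof -
      from ab obtain m y m' y' where *: "m \<in> M" "y \<in> carrier R" "a = m \<oplus> y \<otimes> x"
        "m' \<in> M" "y' \<in> carrier R" "b = m' \<oplus> y' \<otimes> x" by blast
      have "a \<oplus> b = (m \<oplus> m') \<oplus> (y \<oplus> y') \<otimes> x"
        using * x Mc by (simp add: l_distr a_ac)
      then show ?thesis using memK[OF L(3)] * by simp
    qed
    show "r \<otimes> a \<in> ?K" if r: "r \<in> carrier R" and a: "a \<in> ?K" for r a
    proof -
      from a obtain m y where *: "m \<in> M" "y \<in> carrier R" "a = m \<oplus> y \<otimes> x" by blast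
      have "r \<otimes> a = r \<otimes> m \<oplus> (r \<otimes> y) \<otimes> x"
        using * x Mc r by (simp add: r_distr m_assoc)
      then show ?thesis using memK[OF L(5)] * r by simp
    qed
  qed
  moreover have "M \<subseteq> ?K"
  proof
    fix m assume "m \<in> M"
    then show "m \<in> ?K" using memK[of m \<zero>] Mc x by simp
  qed
  moreover have "x \<in> ?K" using memK[OF L(2), of \<one>] x by simp
  ultimately have "?K = carrier R" using M(3) x(2) by blast
  then have "\<one> \<in> ?K" by simp
  then show ?thesis by blast
qed

lemma mem_jacobson_radical_iff:
  "x \<in> jacobson_radical R \<longleftrightarrow> x \<in> carrier R \<and> (\<forall>M. maximal_left_ideal R M \<longrightarrow> x \<in> M)"
  by (auto simp: jacobson_radical_def)

lemma left_ideal_jacobson_radical: "left_ideal R (jacobson_radical R)"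
proof (rule left_idealI)
  show "jacobson_radical R \<subseteq> carrier R" by (auto simp: jacobson_radical_def)
qed (auto simp: mem_jacobson_radical_iff maximal_left_idealD(1) left_idealD(2,3,5))

lemma one_minus_jacobson_radical_left_invertible:
  assumes j: "j \<in> jacobson_radical R"
  shows "\<exists>p\<in>carrier R. p \<otimes> (\<one> \<ominus> j) = \<one>"
proof (rule ccontr)
  assume neg: "\<not> ?thesis"
  have jc: "j \<in> carrier R" using j by (simp add: mem_jacobson_radical_iff)
  let ?L = "{r \<otimes> (\<one> \<ominus> j) | r. r \<in> carrier R}"
  have "left_ideal R ?L" using left_ideal_principal jc by simp
  moreover have "\<one> \<notin> ?L" using neg by auto
  ultimately obtain M where M: "maximal_left_ideal R M" "?L \<subseteq> M"
    using ex_maximal_left_ideal by blast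
  have "\<one> \<otimes> (\<one> \<ominus> j) \<in> ?L" by blast
  then have "\<one> \<ominus> j \<in> M" using M(2) jc by auto
  moreover have "j \<in> M" using j M(1) by (simp add: mem_jacobson_radical_iff)
  ultimately have "(\<one> \<ominus> j) \<oplus> j \<in> M" using left_idealD(3) maximal_left_idealD(1) M(1) by blast
  moreover have "(\<one> \<ominus> j) \<oplus> j = \<one>" using jc by (simp add: minus_eq a_assoc l_neg)
  ultimately show False using maximal_left_idealD(2)[OF M(1)] by simp
qed

text \<open>The left inverse \<open>p\<close> of \<open>1 - j\<close> equals \<open>1 - (- p j)\<close>, again of the form to which left invertibility
applies; an element with left inverse \<open>p\<close>, where \<open>p\<close> is itself left invertible, is a unit.\<close>

lemma one_minus_jacobson_radical_Units:
  assumes j: "j \<in> jacobson_radical R"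
  shows "\<one> \<ominus> j \<in> Units R"
proof -
  have jc: "j \<in> carrier R" using j by (simp add: mem_jacobson_radical_iff)
  obtain p where p: "p \<in> carrier R" "p \<otimes> (\<one> \<ominus> j) = \<one>"
    using one_minus_jacobson_radical_left_invertible[OF j] by blast
  have "p \<otimes> (\<one> \<ominus> j) = p \<ominus> p \<otimes> j" using p(1) jc by (simp add: minus_eq r_distr r_minus)
  then have p1: "p \<ominus> p \<otimes> j = \<one>" using p(2) by simp
  have "p = (p \<ominus> p \<otimes> j) \<oplus> p \<otimes> j" using p(1) jc by (simp add: minus_eq a_assoc l_neg)
  also have "\<dots> = \<one> \<ominus> (\<ominus> p \<otimes> j)" unfolding p1 using p(1) jc by (simp add: minus_eq l_minus)
  finally have peq: "\<one> \<ominus> (\<ominus> p \<otimes> j) = p" by simp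
  have "\<ominus> p \<otimes> j \<in> jacobson_radical R"
    using left_idealD(5)[OF left_ideal_jacobson_radical _ j] p(1) by simp
  from one_minus_jacobson_radical_left_invertible[OF this]
  obtain q where q: "q \<in> carrier R" "q \<otimes> p = \<one>" unfolding peq by blast
  have "q = q \<otimes> (p \<otimes> (\<one> \<ominus> j))" using p q by simp
  also have "\<dots> = \<one> \<ominus> j" using p(1) q jc by (simp add: m_assoc[symmetric])
  finally show ?thesis using p q unfolding Units_def by blast
qed

text \<open>For a maximal left ideal \<open>M\<close> and \<open>r \<notin> M\<close> the left ideal \<open>{z. z r \<in> M}\<close> is maximal too, being the
annihilator of the nonzero element \<open>r + M\<close> of the simple module \<open>R / M\<close>. So it contains the radical.\<close>

lemma jacobson_radical_right_mult:
  assumes x: "x \<in> jacobson_radical R" and r: "r \<in> carrier R"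
  shows "x \<otimes> r \<in> jacobson_radical R"
  unfolding mem_jacobson_radical_iff
proof (intro conjI allI impI)
  have xc: "x \<in> carrier R" using x by (simp add: mem_jacobson_radical_iff)
  then show "x \<otimes> r \<in> carrier R" using r by simp
  fix M assume max: "maximal_left_ideal R M"
  note M = maximal_left_idealD[OF max]
  note L = left_idealD[OF M(1)]
  show "x \<otimes> r \<in> M"
  proof (cases "r \<in> M")
    case True
    then show ?thesis using L(5) xc by blast
  next
    case False
    let ?K = "{z \<in> carrier R. z \<otimes> r \<in> M}"
    have "maximal_left_ideal R ?K"
    proof (rule maximal_left_idealI)
      show "left_ideal R ?K"
        using r L by (intro left_idealI) (auto simp: l_distr m_assoc)
      show "\<one> \<notin> ?K" using False r by simp
      fix N assume N: "left_ideal R N" "?K \<subseteq> N" "\<one> \<notin> N"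
      note LN = left_idealD[OF N(1)]
      have "z \<in> ?K" if z: "z \<in> N" for z
      proof (rule ccontr)
        assume "z \<notin> ?K"
        moreover have zc: "z \<in> carrier R" using z LN(1) by blast
        ultimately obtain m y where my: "m \<in> M" "y \<in> carrier R" "\<one> = m \<oplus> y \<otimes> (z \<otimes> r)"
          using maximal_left_ideal_complement[OF max, of "z \<otimes> r"] r by auto
        have mc: "m \<in> carrier R" using my(1) L(1) by blast
        have "r = r \<otimes> (m \<oplus> y \<otimes> (z \<otimes> r))" using my(3)[symmetric] r by simp
        also have "\<dots> = r \<otimes> m \<oplus> r \<otimes> y \<otimes> z \<otimes> r"
          using r mc my(2) zc by (simp add: r_distr m_assoc)
        finally have "r \<ominus> r \<otimes> y \<otimes> z \<otimes> r = r \<otimes> m \<oplus> r \<otimes> y \<otimes> z \<otimes> r \<ominus> r \<otimes> y \<otimes> z \<otimes> r"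
          by simp
        also have "\<dots> = r \<otimes> m" using r mc my(2) zc by (simp add: minus_eq a_assoc r_neg)
        finally have "(\<one> \<ominus> r \<otimes> y \<otimes> z) \<otimes> r = r \<otimes> m"
          using r my(2) zc by (simp add: minus_eq l_distr l_minus)
        then have "\<one> \<ominus> r \<otimes> y \<otimes> z \<in> ?K" using L(5) my(1,2) r zc by simp
        then have "\<one> \<ominus> r \<otimes> y \<otimes> z \<in> N" using N(2) by blast
        moreover have "r \<otimes> y \<otimes> z \<in> N" using LN(5) z r my(2) by simp
        ultimately have "(\<one> \<ominus> r \<otimes> y \<otimes> z) \<oplus> r \<otimes> y \<otimes> z \<in> N" using LN(3) by blast
        then show False using N(3) r my(2) zc by (simp add: minus_eq a_assoc l_neg)
      qed
      then show "N = ?K" using N(2) by blast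
    qed
    then show ?thesis using x by (auto simp: mem_jacobson_radical_iff)
  qed
qed

lemma ideal_jacobson_radical: "ideal (jacobson_radical R) R"
proof (rule idealI)
  show "subgroup (jacobson_radical R) (add_monoid R)"
    using left_ideal_jacobson_radical by (simp add: left_ideal_def additive_subgroup_def)
qed (use ring_axioms left_idealD(5)[OF left_ideal_jacobson_radical] jacobson_radical_right_mult in auto)

text \<open>The radical contains every square-zero left ideal \<open>R x\<close>. In place of the semiprimeness of the
semisimple quotient, this suffices to make an idempotent with \<open>e R (1 - e) = 0\<close> central there.\<close>

lemma square_zero_mem_jacobson_radical:
  assumes x: "x \<in> carrier R" and sq: "\<And>r. r \<in> carrier R \<Longrightarrow> x \<otimes> r \<otimes> x = \<zero>"
  shows "x \<in> jacobson_radical R"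
  unfolding mem_jacobson_radical_iff
proof (intro conjI allI impI x)
  fix M assume max: "maximal_left_ideal R M"
  note M = maximal_left_idealD[OF max]
  note L = left_idealD[OF M(1)]
  show "x \<in> M"
  proof (rule ccontr)
    assume "x \<notin> M"
    then obtain m y where my: "m \<in> M" "y \<in> carrier R" "\<one> = m \<oplus> y \<otimes> x"
      using maximal_left_ideal_complement[OF max x] by blast
    have mc: "m \<in> carrier R" using my(1) L(1) by blast
    have "y \<otimes> x = y \<otimes> x \<otimes> (m \<oplus> y \<otimes> x)" using my(2) my(3)[symmetric] x by simp
    also have "\<dots> = y \<otimes> x \<otimes> m \<oplus> y \<otimes> (x \<otimes> y \<otimes> x)"
      using my(2) x mc by (simp add: r_distr m_assoc)
    also have "\<dots> = y \<otimes> x \<otimes> m" using sq my(2) x mc by simp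
    finally have "y \<otimes> x \<in> M" using L(5)[OF _ my(1), of "y \<otimes> x"] my(2) x by simp
    then show False using L(3)[OF my(1)] my(3) M(2) by simp
  qed
qed

end

section \<open>Idempotents modulo the radical\<close>

text \<open>The ideal generated by a central element \<open>h\<close> is \<open>R h\<close>.\<close>

lemma (in ring) simple_ring_central_idempotent:
  assumes simple: "\<And>I. ideal I R \<Longrightarrow> I = {\<zero>} \<or> I = carrier R"
    and h: "is_idempotent R h" and central: "\<And>r. r \<in> carrier R \<Longrightarrow> h \<otimes> r = r \<otimes> h"
  shows "h = \<zero> \<or> h = \<one>"
proof -
  note h = is_idempotentD[OF h]
  let ?K = "{r \<otimes> h | r. r \<in> carrier R}"
  have L: "left_ideal R ?K" by (rule left_ideal_principal[OF h(1)])
  have "ideal ?K R"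
  proof (rule idealI[OF ring_axioms])
    show "subgroup ?K (add_monoid R)"
      using L by (simp add: left_ideal_def additive_subgroup_def)
    show "x \<otimes> a \<in> ?K" if "a \<in> ?K" "x \<in> carrier R" for a x
      using left_idealD(5)[OF L] that by blast
    show "a \<otimes> x \<in> ?K" if a: "a \<in> ?K" and x: "x \<in> carrier R" for a x
    proof -
      from a obtain r where r: "r \<in> carrier R" "a = r \<otimes> h" by blast
      have "a \<otimes> x = (r \<otimes> x) \<otimes> h" using r x h central[OF x] by (simp add: m_assoc)
      then show ?thesis using r x by blast
    qed
  qed
  then have "?K = {\<zero>} \<or> ?K = carrier R" by (rule simple)
  then show ?thesis
  proof
    assume K: "?K = {\<zero>}"
    have "\<one> \<otimes> h \<in> ?K" by blast
    then show ?thesis using K h by simp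
  next
    assume "?K = carrier R"
    then have "\<one> \<in> ?K" by simp
    then obtain r where r: "r \<in> carrier R" "\<one> = r \<otimes> h" by blast
    then have "h = r \<otimes> h \<otimes> h" using l_one[OF h(1)] by simp
    also have "\<dots> = r \<otimes> h" using r(1) h by (simp add: m_assoc)
    finally show ?thesis using r by simp
  qed
qed

text \<open>The element \<open>c p\<close> is a central idempotent of the simple ring \<open>B\<close> with identity \<open>c\<close>.\<close>

lemma (in ring) central_idempotent_simple_factor:
  assumes B: "ideal B R" and simple: "simple_artinian_ring (R\<lparr>carrier := B, one := c\<rparr>)"
    and p: "is_idempotent R p" and central: "\<And>r. r \<in> carrier R \<Longrightarrow> p \<otimes> r = r \<otimes> p"
  shows "c \<otimes> p = \<zero> \<or> c \<otimes> p = c"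
proof -
  let ?B = "R\<lparr>carrier := B, one := c\<rparr>"
  interpret B: ring ?B using simple by (simp add: simple_artinian_ring_def)
  interpret I: ideal B R by fact
  note p = is_idempotentD[OF p]
  have cB: "c \<in> B" using B.one_closed by simp
  have cc: "c \<in> carrier R" using cB I.Icarr by blast
  have cb: "c \<otimes> b = b" "b \<otimes> c = b" if "b \<in> B" for b
    using B.l_one[of b] B.r_one[of b] that by auto
  have hB: "c \<otimes> p \<in> B" using I.I_r_closed[OF cB p(1)] .
  have "c \<otimes> p \<otimes> (c \<otimes> p) = c \<otimes> (p \<otimes> c) \<otimes> p" using cc p(1) by (simp add: m_assoc)
  also have "\<dots> = (c \<otimes> c) \<otimes> (p \<otimes> p)" using central[OF cc] cc p(1) by (simp add: m_assoc)
  finally have "is_idempotent ?B (c \<otimes> p)"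
    using hB cb[OF cB] p by (simp add: is_idempotent_def)
  moreover have "c \<otimes> p \<otimes> b = b \<otimes> (c \<otimes> p)" if b: "b \<in> B" for b
  proof -
    have bc: "b \<in> carrier R" using b I.Icarr by blast
    have "c \<otimes> p \<otimes> b = (c \<otimes> b) \<otimes> p" using central[OF bc] cc bc p(1) by (simp add: m_assoc)
    also have "\<dots> = (b \<otimes> c) \<otimes> p" using cb[OF b] by simp
    finally show ?thesis using cc bc p(1) by (simp add: m_assoc)
  qed
  ultimately have "c \<otimes> p = \<zero>\<^bsub>?B\<^esub> \<or> c \<otimes> p = \<one>\<^bsub>?B\<^esub>"
    using simple by (intro B.simple_ring_central_idempotent) (auto simp: simple_artinian_ring_def)
  then show ?thesis by simp
qed

text \<open>The intertwiner \<open>l = f e + (1 - f) (1 - e)\<close> satisfies \<open>l e = f e = f l\<close> for any two idempotents. It is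
\<open>1\<close> modulo the radical, because \<open>1 - l = (1 - f) (e - f) - f (e - f)\<close>.\<close>

lemma (in ring) conjugate_if_congruent_mod_radical:
  assumes e: "is_idempotent R e" and f: "is_idempotent R f"
    and cong: "e \<ominus> f \<in> jacobson_radical R"
  shows "\<exists>l\<in>Units R. l \<otimes> e = f \<otimes> l"
proof -
  note e = is_idempotentD[OF e] and fi = f and f = is_idempotentD[OF f]
  note fc = idempotent_complement[OF fi]
  define l where "l = f \<otimes> e \<oplus> (\<one> \<ominus> f) \<otimes> (\<one> \<ominus> e)"
  have lc: "l \<in> carrier R" using e f by (simp add: l_def)
  have "(\<one> \<ominus> f) \<otimes> (\<one> \<ominus> e) \<otimes> e = \<zero>"
    using e f by (simp add: m_assoc minus_eq l_distr l_minus r_neg)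
  then have le: "l \<otimes> e = f \<otimes> e" using e f by (simp add: l_def l_distr m_assoc)
  have "f \<otimes> ((\<one> \<ominus> f) \<otimes> (\<one> \<ominus> e)) = (f \<otimes> (\<one> \<ominus> f)) \<otimes> (\<one> \<ominus> e)"
    using e f by (simp add: m_assoc)
  then have fl: "f \<otimes> l = f \<otimes> e"
    using fc(2) e f by (simp add: l_def r_distr m_assoc[symmetric])
  have "(\<one> \<ominus> f) \<otimes> (e \<ominus> f) \<ominus> f \<otimes> (e \<ominus> f) \<in> jacobson_radical R"
    using left_idealD(4,5)[OF left_ideal_jacobson_radical] cong f by simp
  moreover have "(\<one> \<ominus> f) \<otimes> (e \<ominus> f) \<ominus> f \<otimes> (e \<ominus> f) = \<one> \<ominus> l"
  proof -
    have 1: "(\<one> \<ominus> f) \<otimes> (e \<ominus> f) = e \<ominus> f \<otimes> e"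
      using e f fc(3) by (simp add: minus_eq r_distr l_distr r_minus l_minus a_assoc r_neg2 minus_add r_neg l_neg a_ac)
    have 2: "f \<otimes> (e \<ominus> f) = f \<otimes> e \<ominus> f"
      using e f by (simp add: minus_eq r_distr r_minus)
    have 3: "l = f \<otimes> e \<oplus> (\<one> \<ominus> e \<ominus> f \<oplus> f \<otimes> e)"
      using e f by (simp add: l_def minus_eq r_distr l_distr r_minus l_minus minus_add a_ac)
    show ?thesis unfolding 1 2 3 using e f
      by (simp add: minus_eq minus_add a_assoc a_ac r_neg r_neg2 r_neg1)
  qed
  ultimately have "\<one> \<ominus> (\<one> \<ominus> l) \<in> Units R"
    using one_minus_jacobson_radical_Units by simp
  moreover have "\<one> \<ominus> (\<one> \<ominus> l) = l" using lc by (simp add: minus_eq minus_add r_neg2)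
  ultimately have "l \<in> Units R" by simp
  then show ?thesis using le fl by (intro bexI[of _ l]) simp_all
qed

lemma (in ring) lifted_idempotentsD:
  assumes lift: "lifted_idempotents R n B c \<epsilon>"
  shows "\<And>i. i \<in> {1..n} \<Longrightarrow> is_idempotent R (\<epsilon> i)"
    and "\<And>i j. i \<in> {1..n} \<Longrightarrow> j \<in> {1..n} \<Longrightarrow> i \<noteq> j \<Longrightarrow> \<epsilon> i \<otimes> \<epsilon> j = \<zero>"
    and "(\<Oplus>i\<in>{1..n}. \<epsilon> i) = \<one>"
    and "\<And>i. i \<in> {1..n} \<Longrightarrow> jacobson_radical R +> \<epsilon> i = c i"
    and "\<And>i. i \<in> {1..n} \<Longrightarrow> ideal (B i) (R Quot jacobson_radical R)"
    and "\<And>i. i \<in> {1..n} \<Longrightarrow>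
      simple_artinian_ring ((R Quot jacobson_radical R)\<lparr>carrier := B i, one := c i\<rparr>)"
  using lift by (auto simp: lifted_idempotents_def product_of_simple_artinians_def)

lemma (in ring) lifted_idempotent_nonzero:
  assumes lift: "lifted_idempotents R n B c \<epsilon>" and i: "i \<in> {1..n}"
  shows "\<epsilon> i \<noteq> \<zero>"
proof
  note D = lifted_idempotentsD[OF lift]
  interpret J: ideal "jacobson_radical R" R by (rule ideal_jacobson_radical)
  assume "\<epsilon> i = \<zero>"
  then have "c i = jacobson_radical R" using D(4)[OF i] J.a_rcos_const[of \<zero>] by simp
  moreover have "c i \<noteq> \<zero>\<^bsub>R Quot jacobson_radical R\<^esub>"
    using D(6)[OF i] by (simp add: simple_artinian_ring_def)
  ultimately show False by (simp add: FactRing_def)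
qed

lemma (in ring) idem_sum_props:
  assumes lift: "lifted_idempotents R n B c \<epsilon>" and I: "I \<subseteq> {1..n}"
  shows "is_idempotent R (idem_sum R \<epsilon> I)" and "I \<noteq> {} \<Longrightarrow> idem_sum R \<epsilon> I \<noteq> \<zero>"
proof -
  note D = lifted_idempotentsD[OF lift]
  have fin: "finite I" using I finite_subset by blast
  have cl: "\<epsilon> \<in> I \<rightarrow> carrier R" using D(1) I by (auto simp: is_idempotent_def)
  have ec: "idem_sum R \<epsilon> I \<in> carrier R" unfolding idem_sum_def using cl by simp
  have mult: "\<epsilon> i \<otimes> idem_sum R \<epsilon> I = \<epsilon> i" if i: "i \<in> I" for i
  proof -
    have orth: "\<epsilon> i \<otimes> \<epsilon> j = \<zero>" if "j \<in> I" "i \<noteq> j" for j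
      using D(2)[of i j] I i that by blast
    have ic: "\<epsilon> i \<in> carrier R" "\<epsilon> i \<otimes> \<epsilon> i = \<epsilon> i" using D(1)[of i] I i by (auto simp: is_idempotent_def)
    have "\<epsilon> i \<otimes> idem_sum R \<epsilon> I = (\<Oplus>j\<in>I. \<epsilon> i \<otimes> \<epsilon> j)"
      unfolding idem_sum_def using fin ic cl by (simp add: finsum_rdistr)
    also have "\<dots> = (\<Oplus>j\<in>I. if i = j then \<epsilon> j else \<zero>)"
      using orth ic cl by (intro finsum_cong') auto
    also have "\<dots> = \<epsilon> i" using add.finprod_singleton[OF i fin cl] by simp
    finally show ?thesis .
  qed
  have "idem_sum R \<epsilon> I \<otimes> idem_sum R \<epsilon> I = (\<Oplus>j\<in>I. \<epsilon> j \<otimes> idem_sum R \<epsilon> I)"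
    using fin ec cl finsum_ldistr[OF fin ec cl] by (simp add: idem_sum_def)
  also have "\<dots> = idem_sum R \<epsilon> I"
    unfolding idem_sum_def[of R \<epsilon> I] using mult cl by (intro finsum_cong') (auto simp: idem_sum_def)
  finally show "is_idempotent R (idem_sum R \<epsilon> I)" using ec by (simp add: is_idempotent_def)
  show "idem_sum R \<epsilon> I \<noteq> \<zero>" if "I \<noteq> {}"
  proof -
    from that obtain i where i: "i \<in> I" by blast
    have "\<epsilon> i \<in> carrier R" using cl i by auto
    then show ?thesis using mult[OF i] lifted_idempotent_nonzero[OF lift, of i] I i by auto
  qed
qed

text \<open>Modulo the radical \<open>e\<close> becomes a central idempotent of a product of simple rings, so it is the sum of
the identities of those factors on which it does not vanish. These factors form \<open>I\<close>.\<close>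

lemma (in ring) left_absorbing_idempotent_congruent_idem_sum:
  assumes lift: "lifted_idempotents R n B c \<epsilon>"
    and e: "is_idempotent R e" "e \<noteq> \<zero>"
    and absorb: "\<And>r. r \<in> carrier R \<Longrightarrow> e \<otimes> r \<otimes> e = e \<otimes> r"
  shows "\<exists>I. I \<noteq> {} \<and> I \<subseteq> {1..n} \<and> e \<ominus> idem_sum R \<epsilon> I \<in> jacobson_radical R"
proof -
  let ?J = "jacobson_radical R"
  let ?Q = "R Quot ?J"
  note D = lifted_idempotentsD[OF lift]
  note ei = is_idempotentD[OF e(1)]
  interpret J: ideal ?J R by (rule ideal_jacobson_radical)
  interpret Q: ring ?Q by (rule J.quotient_is_ring)
  have Qc: "carrier ?Q = {?J +> r | r. r \<in> carrier R}"
    by (auto simp: FactRing_def A_RCOSETS_def')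
  have Qm: "(?J +> a) \<otimes>\<^bsub>?Q\<^esub> (?J +> b) = ?J +> (a \<otimes> b)" if "a \<in> carrier R" "b \<in> carrier R" for a b
    using J.rcoset_mult_add[OF that] by (simp add: FactRing_def)
  have Qe: "?J +> a = ?J +> b \<longleftrightarrow> a \<ominus> b \<in> ?J" if "a \<in> carrier R" "b \<in> carrier R" for a b
    using quotient_eq_iff_same_a_r_cos[OF J.is_ideal that] by simp
  have Qz: "\<zero>\<^bsub>?Q\<^esub> = ?J +> \<zero>" using J.a_rcos_const[of \<zero>] by (simp add: FactRing_def)
  have comm: "e \<otimes> r \<ominus> r \<otimes> e \<in> ?J" if r: "r \<in> carrier R" for r
  proof -
    \<comment> \<open>The commutator \<open>x = (1 - e) r e\<close> satisfies \<open>x R x = 0\<close>.\<close>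
    define x where "x = r \<otimes> e \<ominus> e \<otimes> r"
    have xc: "x \<in> carrier R" using r ei by (simp add: x_def)
    have ex: "e \<otimes> x = \<zero>"
      using absorb[OF r] r ei by (simp add: x_def minus_eq r_distr r_minus m_assoc[symmetric] r_neg)
    have xe: "x \<otimes> e = x"
      using absorb[OF r] r ei by (simp add: x_def minus_eq l_distr l_minus m_assoc)
    have "x \<otimes> q \<otimes> x = \<zero>" if q: "q \<in> carrier R" for q
    proof -
      have "x \<otimes> q \<otimes> x = x \<otimes> e \<otimes> q \<otimes> x" using xe by simp
      also have "\<dots> = x \<otimes> (e \<otimes> q) \<otimes> x" using xc ei q by (simp add: m_assoc)
      also have "\<dots> = x \<otimes> (e \<otimes> q \<otimes> e) \<otimes> x" using absorb[OF q] by simp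
      also have "\<dots> = x \<otimes> e \<otimes> q \<otimes> (e \<otimes> x)" using xc ei(1) q by (simp add: m_assoc)
      finally show ?thesis using ex xc ei q by simp
    qed
    then have "x \<in> ?J" using square_zero_mem_jacobson_radical xc by blast
    then have "(\<ominus> \<one>) \<otimes> x \<in> ?J" using J.I_l_closed by simp
    moreover have "(\<ominus> \<one>) \<otimes> x = e \<otimes> r \<ominus> r \<otimes> e"
      using r ei xc by (simp add: l_minus) (simp add: x_def minus_eq minus_add a_comm)
    ultimately show ?thesis by simp
  qed
  have idem: "is_idempotent ?Q (?J +> e)"
    using ei Qc Qm by (auto simp: is_idempotent_def)
  have central: "(?J +> e) \<otimes>\<^bsub>?Q\<^esub> q = q \<otimes>\<^bsub>?Q\<^esub> (?J +> e)" if q: "q \<in> carrier ?Q" for q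
  proof -
    from q obtain r where "r \<in> carrier R" "q = ?J +> r" using Qc by auto
    then show ?thesis using Qm Qe comm ei by simp
  qed
  define I where "I = {i \<in> {1..n}. \<epsilon> i \<otimes> e \<ominus> \<epsilon> i \<in> ?J}"
  have I: "I \<subseteq> {1..n}" by (auto simp: I_def)
  have \<epsilon>c: "\<epsilon> i \<in> carrier R" if "i \<in> {1..n}" for i
    using D(1)[OF that] by (simp add: is_idempotent_def)
  have notI: "\<epsilon> i \<otimes> e \<in> ?J" if i: "i \<in> {1..n}" "i \<notin> I" for i
  proof -
    have "c i \<otimes>\<^bsub>?Q\<^esub> (?J +> e) = \<zero>\<^bsub>?Q\<^esub> \<or> c i \<otimes>\<^bsub>?Q\<^esub> (?J +> e) = c i"
      by (rule Q.central_idempotent_simple_factor[OF D(5,6)[OF i(1)] idem central])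
    then have "?J +> (\<epsilon> i \<otimes> e) = ?J +> \<zero> \<or> ?J +> (\<epsilon> i \<otimes> e) = ?J +> \<epsilon> i"
      using D(4)[OF i(1), symmetric] Qm \<epsilon>c[OF i(1)] ei Qz by simp
    then show ?thesis using Qe \<epsilon>c[OF i(1)] ei i by (auto simp: I_def minus_eq)
  qed
  \<comment> \<open>Summing over all factors gives the claim, as \<open>e = 1 e = \<Sum>i. \<epsilon> i e\<close>.\<close>
  have "(\<Oplus>i\<in>A. \<epsilon> i \<otimes> e) \<ominus> (\<Oplus>i\<in>A \<inter> I. \<epsilon> i) \<in> ?J" if "finite A" "A \<subseteq> {1..n}" for A
    using that
  proof (induction A rule: finite_induct)
    case empty
    then show ?case by (simp add: minus_eq)
  next
    case (insert a A)
    have c1: "(\<lambda>i. \<epsilon> i \<otimes> e) \<in> A \<rightarrow> carrier R" and c2: "\<epsilon> \<in> A \<inter> I \<rightarrow> carrier R"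
      and ac: "\<epsilon> a \<in> carrier R"
      using insert \<epsilon>c ei by auto
    note sc = finsum_closed[OF c1] finsum_closed[OF c2]
    have s1: "(\<Oplus>i\<in>insert a A. \<epsilon> i \<otimes> e) = \<epsilon> a \<otimes> e \<oplus> (\<Oplus>i\<in>A. \<epsilon> i \<otimes> e)"
      using insert c1 ac ei by (intro finsum_insert) auto
    show ?case
    proof (cases "a \<in> I")
      case True
      then have "insert a A \<inter> I = insert a (A \<inter> I)" by auto
      moreover have "(\<Oplus>i\<in>insert a (A \<inter> I). \<epsilon> i) = \<epsilon> a \<oplus> (\<Oplus>i\<in>A \<inter> I. \<epsilon> i)"
        using insert c2 ac by (intro finsum_insert) auto
      ultimately have "(\<Oplus>i\<in>insert a A. \<epsilon> i \<otimes> e) \<ominus> (\<Oplus>i\<in>insert a A \<inter> I. \<epsilon> i) =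
          (\<epsilon> a \<otimes> e \<ominus> \<epsilon> a) \<oplus> ((\<Oplus>i\<in>A. \<epsilon> i \<otimes> e) \<ominus> (\<Oplus>i\<in>A \<inter> I. \<epsilon> i))"
        using s1 sc ac ei by (simp add: minus_eq minus_add a_ac)
      then show ?thesis using insert True by (auto simp: I_def intro: J.a_closed)
    next
      case False
      then have "(\<Oplus>i\<in>insert a A. \<epsilon> i \<otimes> e) \<ominus> (\<Oplus>i\<in>insert a A \<inter> I. \<epsilon> i) =
          \<epsilon> a \<otimes> e \<oplus> ((\<Oplus>i\<in>A. \<epsilon> i \<otimes> e) \<ominus> (\<Oplus>i\<in>A \<inter> I. \<epsilon> i))"
        using s1 sc ac ei by (simp add: minus_eq a_ac)
      then show ?thesis using insert notI[OF _ False] by (auto intro: J.a_closed)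
    qed
  qed
  from this[of "{1..n}"] have "(\<Oplus>i\<in>{1..n}. \<epsilon> i \<otimes> e) \<ominus> idem_sum R \<epsilon> I \<in> ?J"
    using I by (simp add: idem_sum_def Int_absorb1)
  moreover have "(\<Oplus>i\<in>{1..n}. \<epsilon> i \<otimes> e) = (\<Oplus>i\<in>{1..n}. \<epsilon> i) \<otimes> e"
    using \<epsilon>c ei by (intro finsum_ldistr[symmetric]) auto
  ultimately have cong: "e \<ominus> idem_sum R \<epsilon> I \<in> ?J" using D(3) ei by simp
  moreover have "I \<noteq> {}"
  proof
    \<comment> \<open>Otherwise \<open>e\<close> is in the radical, so \<open>1 - e\<close> is a unit that annihilates \<open>e\<close>.\<close>
    assume "I = {}"
    then have "e \<in> ?J" using cong ei by (simp add: idem_sum_def minus_eq)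
    then have u: "\<one> \<ominus> e \<in> Units R" by (rule one_minus_jacobson_radical_Units)
    have "e = e \<otimes> ((\<one> \<ominus> e) \<otimes> inv (\<one> \<ominus> e))" using u ei by simp
    also have "\<dots> = e \<otimes> (\<one> \<ominus> e) \<otimes> inv (\<one> \<ominus> e)" using u ei(1) by (simp add: m_assoc)
    also have "\<dots> = \<zero>" using idempotent_complement(2)[OF e(1)] u by simp
    finally show False using e(2) by simp
  qed
  ultimately show ?thesis using I by blast
qed

section \<open>Conjugation\<close>

lemma (in ring) conjugate_mult:
  assumes "l \<in> Units R" "x \<in> carrier R" "y \<in> carrier R"
  shows "(l \<otimes> x \<otimes> inv l) \<otimes> (l \<otimes> y \<otimes> inv l) = l \<otimes> (x \<otimes> y) \<otimes> inv l"
proof -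
  have l: "l \<in> carrier R" "inv l \<in> carrier R" using assms by auto
  have "(l \<otimes> x \<otimes> inv l) \<otimes> (l \<otimes> y \<otimes> inv l) = l \<otimes> x \<otimes> (inv l \<otimes> l) \<otimes> y \<otimes> inv l"
    using l assms(2,3) by (simp add: m_assoc)
  then show ?thesis using l assms by (simp add: m_assoc)
qed

lemma (in ring) conjugate_back:
  assumes "l \<in> Units R" "x \<in> carrier R"
  shows "inv l \<otimes> (l \<otimes> x \<otimes> inv l) \<otimes> l = x" "l \<otimes> (inv l \<otimes> x \<otimes> l) \<otimes> inv l = x"
proof -
  have l: "l \<in> carrier R" "inv l \<in> carrier R" using assms by auto
  have "inv l \<otimes> (l \<otimes> x \<otimes> inv l) \<otimes> l = (inv l \<otimes> l) \<otimes> x \<otimes> (inv l \<otimes> l)"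
    using l assms(2) by (simp add: m_assoc)
  then show "inv l \<otimes> (l \<otimes> x \<otimes> inv l) \<otimes> l = x" using assms by simp
  have "l \<otimes> (inv l \<otimes> x \<otimes> l) \<otimes> inv l = (l \<otimes> inv l) \<otimes> x \<otimes> (l \<otimes> inv l)"
    using l assms(2) by (simp add: m_assoc)
  then show "l \<otimes> (inv l \<otimes> x \<otimes> l) \<otimes> inv l = x" using assms by simp
qed

lemma (in ring) multiplicative_set_conjugate:
  assumes l: "l \<in> Units R" and S: "multiplicative_set R S"
  shows "multiplicative_set R {l \<otimes> x \<otimes> inv l | x. x \<in> S}"
proof -
  have lc: "l \<in> carrier R" "inv l \<in> carrier R" using l by auto
  have Sc: "x \<in> carrier R" if "x \<in> S" for x
    using S that by (auto simp: multiplicative_set_def)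
  let ?T = "{l \<otimes> x \<otimes> inv l | x. x \<in> S}"
  have T: "l \<otimes> x \<otimes> inv l \<in> ?T" if "x \<in> S" for x using that by blast
  show ?thesis
    unfolding multiplicative_set_def
  proof (intro conjI ballI)
    show "?T \<subseteq> carrier R" using Sc lc by auto
    have "\<one> = l \<otimes> \<one> \<otimes> inv l" using l lc by simp
    then show "\<one> \<in> ?T" using T[of \<one>] S by (simp add: multiplicative_set_def)
    show "\<zero> \<notin> ?T"
    proof
      assume "\<zero> \<in> ?T"
      then obtain x where x: "x \<in> S" "l \<otimes> x \<otimes> inv l = \<zero>" by auto
      then have "x = \<zero>" using conjugate_back(1)[OF l Sc[OF x(1)]] lc by simp
      then show False using S x(1) by (simp add: multiplicative_set_def)
    qed
    fix a b assume "a \<in> ?T" "b \<in> ?T"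
    then obtain x y where "x \<in> S" "a = l \<otimes> x \<otimes> inv l" "y \<in> S" "b = l \<otimes> y \<otimes> inv l" by blast
    then show "a \<otimes> b \<in> ?T"
      using conjugate_mult[OF l Sc Sc] S T[of "x \<otimes> y"] by (simp add: multiplicative_set_def)
  qed
qed

text \<open>Conjugation by \<open>l\<close> is a ring automorphism.\<close>

lemma (in inverting_idempotent) conjugate:
  assumes l: "l \<in> Units R"
  shows "inverting_idempotent R {l \<otimes> x \<otimes> inv l | x. x \<in> S} (l \<otimes> e \<otimes> inv l) (l \<otimes> s \<otimes> inv l)"
proof
  have lc: "l \<in> carrier R" "inv l \<in> carrier R" using l by auto
  note cm = conjugate_mult[OF l]
  show "multiplicative_set R {l \<otimes> x \<otimes> inv l | x. x \<in> S}"
    by (rule multiplicative_set_conjugate[OF l mult_set])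
  show "is_idempotent R (l \<otimes> e \<otimes> inv l)"
    using lc cm by (simp add: is_idempotent_def)
  show "l \<otimes> e \<otimes> inv l \<otimes> r \<otimes> (l \<otimes> e \<otimes> inv l) = l \<otimes> e \<otimes> inv l \<otimes> r" if r: "r \<in> carrier R" for r
  proof -
    define q where "q = inv l \<otimes> r \<otimes> l"
    have q: "q \<in> carrier R" "r = l \<otimes> q \<otimes> inv l"
      using lc r conjugate_back(2)[OF l r] by (simp_all add: q_def)
    show ?thesis unfolding q(2) using q(1) absorb[OF q(1)] by (simp add: cm)
  qed
  show "\<exists>y\<in>carrier R. l \<otimes> e \<otimes> inv l \<otimes> y = y \<and> y \<otimes> x = l \<otimes> e \<otimes> inv l \<and>
      l \<otimes> e \<otimes> inv l \<otimes> x \<otimes> y = l \<otimes> e \<otimes> inv l" if x: "x \<in> {l \<otimes> x \<otimes> inv l | x. x \<in> S}" for x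
  proof -
    from x obtain z where z: "z \<in> S" "x = l \<otimes> z \<otimes> inv l" by blast
    obtain y where "y \<in> carrier R" "e \<otimes> y = y" "y \<otimes> z = e" "e \<otimes> z \<otimes> y = e"
      using inverse[OF z(1)] by blast
    then show ?thesis
      using z lc by (intro bexI[of _ "l \<otimes> y \<otimes> inv l"]) (simp_all add: cm)
  qed
  show "l \<otimes> s \<otimes> inv l \<in> {l \<otimes> x \<otimes> inv l | x. x \<in> S}" using s_in by blast
  show "l \<otimes> s \<otimes> inv l \<otimes> (l \<otimes> e \<otimes> inv l) = l \<otimes> s \<otimes> inv l"
    using s_e by (simp add: cm)
qed

lemma (in ring) conj_block_cond_iff:
  assumes lift: "lifted_idempotents R n B c \<epsilon>" and S: "multiplicative_set R S"
  shows "conj_block_cond R n \<epsilon> S l f s \<longleftrightarrow>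
    l \<in> Units R \<and> f \<in> I_l' R n \<epsilon> \<and> s \<in> S \<and>
    inverting_idempotent R {l \<otimes> x \<otimes> inv l | x. x \<in> S} f (l \<otimes> s \<otimes> inv l)"
proof (cases "l \<in> Units R \<and> f \<in> I_l' R n \<epsilon> \<and> s \<in> S")
  case True
  then obtain I where "f = idem_sum R \<epsilon> I" "I \<noteq> {}" "I \<subseteq> {1..n}" "R12 R f = {\<zero>}"
    by (auto simp: I_l'_def)
  then have "is_idempotent R f" "f \<noteq> \<zero>" "R12 R f = {\<zero>}"
    using idem_sum_props[OF lift] by auto
  moreover have "l \<otimes> s \<otimes> inv l \<in> {l \<otimes> x \<otimes> inv l | x. x \<in> S}" using True by blast
  ultimately show ?thesis
    using True
    unfolding conj_block_cond_def block_cond_def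
      block_cond_iff[OF multiplicative_set_conjugate[OF _ S], symmetric, OF conjunct1[OF True]]
    by simp
next
  case False
  then show ?thesis unfolding conj_block_cond_def by argo
qed

lemma (in ring) inverting_idempotent_of_conjugate:
  assumes l: "l \<in> Units R" and S: "S \<subseteq> carrier R" "s \<in> carrier R"
    and inv: "inverting_idempotent R {l \<otimes> x \<otimes> inv l | x. x \<in> S} f (l \<otimes> s \<otimes> inv l)"
  shows "inverting_idempotent R S (inv l \<otimes> f \<otimes> l) s"
proof -
  interpret C: inverting_idempotent R "{l \<otimes> x \<otimes> inv l | x. x \<in> S}" f "l \<otimes> s \<otimes> inv l" by fact
  have "{inv l \<otimes> y \<otimes> l | y. y \<in> {l \<otimes> x \<otimes> inv l | x. x \<in> S}} =
      (\<lambda>x. inv l \<otimes> (l \<otimes> x \<otimes> inv l) \<otimes> l) ` S" by blast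
  also have "\<dots> = (\<lambda>x. x) ` S"
    using conjugate_back(1)[OF l] S by (intro image_cong) auto
  finally show ?thesis
    using C.conjugate[of "inv l"] l conjugate_back(1)[OF l S(2)] by simp
qed

section \<open>Characterisations of left denominator sets\<close>

lemma (in ring) powers_of_subset:
  assumes S: "multiplicative_set R S" and s: "s \<in> S"
  shows "powers_of R s \<subseteq> S" "multiplicative_set R (powers_of R s)" "s \<in> powers_of R s"
proof -
  have sc: "s \<in> carrier R" using S s by (auto simp: multiplicative_set_def)
  have "s [^] i \<in> S" for i :: nat
    using S s by (induction i) (auto simp: multiplicative_set_def)
  then show sub: "powers_of R s \<subseteq> S" by (auto simp: powers_of_def)
  have "s [^] (0::nat) \<in> powers_of R s" unfolding powers_of_def by (rule rangeI)
  then have "\<one> \<in> powers_of R s" by simp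
  moreover have "x \<otimes> y \<in> powers_of R s" if "x \<in> powers_of R s" "y \<in> powers_of R s" for x y
    using that sc by (auto simp: powers_of_def nat_pow_mult)
  ultimately show "multiplicative_set R (powers_of R s)"
    using S sub by (auto simp: multiplicative_set_def)
  have "s [^] (1::nat) \<in> powers_of R s" unfolding powers_of_def by (rule rangeI)
  then show "s \<in> powers_of R s" using sc by simp
qed

lemma (in ring) Den_l_iff_inverting_idempotent:
  assumes "left_artinian R"
  shows "S \<in> Den_l R \<longleftrightarrow> (\<exists>e s. inverting_idempotent R S e s)"
proof
  show "\<exists>e s. inverting_idempotent R S e s" if "S \<in> Den_l R"
    using assms that by (rule Den_l_imp_inverting_idempotent)
  show "S \<in> Den_l R" if "\<exists>e s. inverting_idempotent R S e s"
    using that by (elim exE) (rule inverting_idempotent.S_in_Den_l)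
qed

text \<open>The same \<open>e\<close> and \<open>s\<close> serve for \<open>S\<close> and for the powers of \<open>s\<close>. Conversely, an idempotent for the powers
of \<open>s\<close> inverts exactly the elements that become units in the localization, hence all of \<open>S\<close>; the
element \<open>t\<close> that comes with it is a power of \<open>s\<close>.\<close>

lemma (in ring) Den_l_iff_powers_localization:
  assumes art: "left_artinian R" and S: "multiplicative_set R S"
  shows "S \<in> Den_l R \<longleftrightarrow> (\<exists>s\<in>S. powers_of R s \<in> Den_l R \<and>
    (\<forall>x\<in>S. loc_map R (powers_of R s) x \<in> Units (left_localization R (powers_of R s))))"
proof
  assume "S \<in> Den_l R"
  then obtain e s where "inverting_idempotent R S e s"
    using Den_l_iff_inverting_idempotent[OF art] by blast
  then interpret inverting_idempotent R S e s .
  note P = powers_of_subset[OF S s_in]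
  interpret P: inverting_idempotent R "powers_of R s" e s
    using P absorb inverse idem s_e by unfold_locales auto
  have "loc_map R (powers_of R s) x \<in> Units (left_localization R (powers_of R s))"
    if "x \<in> S" for x
    using P.loc_map_unit_iff[of x] inverse[OF that] that by simp
  then show "\<exists>s\<in>S. powers_of R s \<in> Den_l R \<and>
    (\<forall>x\<in>S. loc_map R (powers_of R s) x \<in> Units (left_localization R (powers_of R s)))"
    using s_in P.S_in_Den_l by blast
next
  assume "\<exists>s\<in>S. powers_of R s \<in> Den_l R \<and>
    (\<forall>x\<in>S. loc_map R (powers_of R s) x \<in> Units (left_localization R (powers_of R s)))"
  then obtain s where s: "s \<in> S" "powers_of R s \<in> Den_l R"
    and unit: "\<And>x. x \<in> S \<Longrightarrow> loc_map R (powers_of R s) x \<in> Units (left_localization R (powers_of R s))"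
    by blast
  obtain e t where "inverting_idempotent R (powers_of R s) e t"
    using Den_l_iff_inverting_idempotent[OF art] s(2) by blast
  then interpret P: inverting_idempotent R "powers_of R s" e t .
  have "inverting_idempotent R S e t"
  proof
    show "\<exists>y\<in>carrier R. e \<otimes> y = y \<and> y \<otimes> x = e \<and> e \<otimes> x \<otimes> y = e" if "x \<in> S" for x
      using P.loc_map_unit_iff[of x] unit[OF that] S that by (auto simp: multiplicative_set_def)
    show "t \<in> S" using P.s_in powers_of_subset(1)[OF S s(1)] by blast
  qed (fact S P.idem P.absorb P.s_e)+
  then show "S \<in> Den_l R" by (rule inverting_idempotent.S_in_Den_l)
qed

text \<open>The idempotent found for \<open>S\<close> is conjugate to a partial sum of the \<open>\<epsilon> i\<close>, since both have the same
image modulo the radical; conjugating \<open>S\<close> along with it preserves all conditions.\<close>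

lemma (in ring) Den_l_iff_conj_block_cond:
  assumes art: "left_artinian R" and S: "multiplicative_set R S"
    and lift: "lifted_idempotents R n B c \<epsilon>"
  shows "S \<in> Den_l R \<longleftrightarrow> (\<exists>l f s. conj_block_cond R n \<epsilon> S l f s)"
proof
  assume "S \<in> Den_l R"
  then obtain e s where "inverting_idempotent R S e s"
    using Den_l_iff_inverting_idempotent[OF art] by blast
  then interpret inverting_idempotent R S e s .
  obtain I where I: "I \<noteq> {}" "I \<subseteq> {1..n}" "e \<ominus> idem_sum R \<epsilon> I \<in> jacobson_radical R"
    using left_absorbing_idempotent_congruent_idem_sum[OF lift idem e_nonzero absorb] by blast
  let ?f = "idem_sum R \<epsilon> I"
  have f: "is_idempotent R ?f" using idem_sum_props(1)[OF lift I(2)] .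
  obtain l where l: "l \<in> Units R" "l \<otimes> e = ?f \<otimes> l"
    using conjugate_if_congruent_mod_radical[OF idem f I(3)] by blast
  have "l \<otimes> e \<otimes> inv l = ?f"
    using l is_idempotentD(1)[OF f] by (simp add: m_assoc Units_closed)
  with conjugate[OF l(1)]
  have inv: "inverting_idempotent R {l \<otimes> x \<otimes> inv l | x. x \<in> S} ?f (l \<otimes> s \<otimes> inv l)" by simp
  then have "R12 R ?f = {\<zero>}"
    using R12_eq_zero_iff[OF f] inverting_idempotent.absorb[OF inv] by simp
  then have "?f \<in> I_l' R n \<epsilon>" using I by (auto simp: I_l'_def)
  then have "conj_block_cond R n \<epsilon> S l ?f s"
    using conj_block_cond_iff[OF lift S, THEN iffD2] l(1) inv s_in by simp
  then show "\<exists>l f s. conj_block_cond R n \<epsilon> S l f s" by blast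
next
  assume "\<exists>l f s. conj_block_cond R n \<epsilon> S l f s"
  then obtain l f s where "conj_block_cond R n \<epsilon> S l f s" by blast
  then have *: "l \<in> Units R" "s \<in> S"
    "inverting_idempotent R {l \<otimes> x \<otimes> inv l | x. x \<in> S} f (l \<otimes> s \<otimes> inv l)"
    by (simp_all add: conj_block_cond_iff[OF lift S])
  have "S \<subseteq> carrier R" "s \<in> carrier R"
    using S *(2) by (auto simp: multiplicative_set_def)
  from inverting_idempotent_of_conjugate[OF *(1) this *(3)]
  show "S \<in> Den_l R" by (rule inverting_idempotent.S_in_Den_l)
qed

lemma (in ring) ass_eq_lmult_ker_if_conj_block_cond:
  assumes S: "multiplicative_set R S" and lift: "lifted_idempotents R n B c \<epsilon>"
    and cond: "conj_block_cond R n \<epsilon> S l f s"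
  shows "ass R S = lmult_ker R s"
proof -
  have *: "l \<in> Units R" "s \<in> S"
    "inverting_idempotent R {l \<otimes> x \<otimes> inv l | x. x \<in> S} f (l \<otimes> s \<otimes> inv l)"
    using conj_block_cond_iff[OF lift S, THEN iffD1, OF cond] by simp_all
  have "S \<subseteq> carrier R" "s \<in> carrier R"
    using S *(2) by (auto simp: multiplicative_set_def)
  from inverting_idempotent_of_conjugate[OF *(1) this *(3)]
  show ?thesis by (rule inverting_idempotent.ass_eq_lmult_ker)
qed

theorem theorem7p6:
  fixes R :: "('a, 'm) ring_scheme" and S :: "'a set"
  assumes "ring R"
    and "\<one>\<^bsub>R\<^esub> \<noteq> \<zero>\<^bsub>R\<^esub>"
    and "left_artinian R"
    and "multiplicative_set R S"
  shows
    "(S \<in> Den_l R \<longleftrightarrow> (\<exists>e s. block_cond R S e s)) \<and>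
     (S \<in> Den_l R \<longleftrightarrow>
        (\<exists>s\<in>S. powers_of R s \<in> Den_l R \<and>
           (\<forall>x\<in>S. loc_map R (powers_of R s) x \<in> Units (left_localization R (powers_of R s))))) \<and>
     (\<forall>e s. block_cond R S e s \<longrightarrow> ass R S = lmult_ker R s) \<and>
     (\<forall>n B c \<epsilon>. lifted_idempotents R n B c \<epsilon> \<longrightarrow>
        (S \<in> Den_l R \<longleftrightarrow> (\<exists>l e s. conj_block_cond R n \<epsilon> S l e s)) \<and>
        (\<forall>l e s. conj_block_cond R n \<epsilon> S l e s \<longrightarrow> ass R S = lmult_ker R s))"
proof -
  interpret ring R by fact
  show ?thesis
    unfolding block_cond_iff[OF assms(4)]
  proof (intro conjI allI impI)
    show "S \<in> Den_l R \<longleftrightarrow> (\<exists>e s. inverting_idempotent R S e s)"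
      by (rule Den_l_iff_inverting_idempotent[OF assms(3)])
    show "S \<in> Den_l R \<longleftrightarrow> (\<exists>s\<in>S. powers_of R s \<in> Den_l R \<and>
        (\<forall>x\<in>S. loc_map R (powers_of R s) x \<in> Units (left_localization R (powers_of R s))))"
      by (rule Den_l_iff_powers_localization[OF assms(3,4)])
    show "ass R S = lmult_ker R s" if "inverting_idempotent R S e s" for e s
      using that by (rule inverting_idempotent.ass_eq_lmult_ker)
    show "S \<in> Den_l R \<longleftrightarrow> (\<exists>l e s. conj_block_cond R n \<epsilon> S l e s)"
      if "lifted_idempotents R n B c \<epsilon>" for n B c \<epsilon>
      by (rule Den_l_iff_conj_block_cond[OF assms(3,4) that])
    show "ass R S = lmult_ker R s"
      if "lifted_idempotents R n B c \<epsilon>" "conj_block_cond R n \<epsilon> S l e s" for n B c \<epsilon> l e s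
      by (rule ass_eq_lmult_ker_if_conj_block_cond[OF assms(4) that])
  qed
qed

end
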